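(* For a free-infinitely divisible Voiculescu transform $$V_{\tilde C}(it)=i\,[\,1-t\,\beta(t/2)\,],\qquad t\neq 0,$$ we have that in its representation $$V_{\tilde C}(it)=a_{\tilde C}+\int_{\mathbb{R}}\frac{1+itx}{it-x}\,m_{\tilde C}(dx),\qquad t\neq 0,$$ the real parameter is $a_{\tilde C}=0$, and the measure $m_{\tilde C}$ is such that its total mass is $m_{\tilde C}(\mathbb{R})=\frac{\pi}{2}-1\approx 0.57079$ and its characteristic function $\hat m_{\tilde C}$ is equal to $$\hat m_{\tilde C}(s)=2\sinh(s)\,\tan^{-1}(e^{-s})+\frac{\pi}{2}e^{-s}-1=\int_0^\infty\cos(sx)\,\frac{|x|}{1+x^2}\,\frac{1}{\sinh(\pi|x|/2)}\,dx .$$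
   Context: Voiculescu transforms are considered only on the imaginary axis without zero, $i(\mathbb{R}\setminus\{0\})$. In the representation, $a_{\tilde C}\in\mathbb{R}$ and $m_{\tilde C}$ is a non-negative, finite Borel measure on $\mathbb{R}$; its characteristic function is $\hat m_{\tilde C}(s)=\int_{\mathbb{R}}e^{isx}\,m_{\tilde C}(dx)$. The symbol $\tilde C$ indicates a free-probability analogue of the classical hyperbolic cosine characteristic function $\phi_C(t)=1/\cosh(t)$. The beta function of one variable is $\beta(x)=\frac12\left[\psi\left(\frac{x+1}{2}\right)-\psi\left(\frac{x}{2}\right)\right]=\sum_{k=0}^\infty\frac{(-1)^k}{x+k}$ ($-x\notin\mathbb{N}$), where $\psi(z)=\frac{d}{dz}\log\Gamma(z)$ is the digamma function and $\Gamma$ is Euler's gamma function; for $\Re z>0$ it admits the representation $\beta(z)=\int_0^\infty(1+e^{-x})^{-1}e^{-zx}\,dx$. $\tan^{-1}$ denotes the arctangent.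
   Formalization: The formula V(it) = i[1 − tβ(t/2)] is assumed only for t > 0 and extended to t < 0 by V(−it) = conj V(it), since for t < 0 it has poles (t = −2, −4, …) and contradicts the representation (e.g. at t = −1). *)

theory Defs
  imports "HOL-Probability.Probability"
begin

definition beta1 :: "real \<Rightarrow> real" where
  "beta1 x = (Digamma ((x + 1) / 2) - Digamma (x / 2)) / 2"

text \<open>
  \<open>V\<close> is only ever evaluated on the imaginary axis without zero, and \<open>voiculescu_repr V a M\<close>
  says that there it has the representation of a free-infinitely divisible Voiculescu transform
  with parameters \<open>a\<close> and \<open>M\<close>.  The integrand is bounded in \<open>x\<close> for each fixed \<open>t \<noteq> 0\<close>, so it is
  integrable with respect to the finite measure \<open>M\<close>.
\<close>

definition voiculescu_repr :: "(complex \<Rightarrow> complex) \<Rightarrow> real \<Rightarrow> real measure \<Rightarrow> bool" where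
  "voiculescu_repr V a M \<longleftrightarrow>
     finite_measure M \<and> sets M = sets borel \<and>
     (\<forall>t::real. t \<noteq> 0 \<longrightarrow>
        V (\<i> * of_real t) =
          of_real a +
          (CLINT x|M. (1 + \<i> * of_real t * of_real x) / (\<i> * of_real t - of_real x)))"

text \<open>
  As an identity of the digamma function the formula \<open>\<i> (1 - t \<beta>(t/2))\<close> is meant for \<open>t > 0\<close>: for
  \<open>t < 0\<close> the function \<open>t \<mapsto> \<beta>(t/2)\<close> has poles at the negative even integers.  On the lower
  half of the axis a Voiculescu transform is determined by \<open>V (cnj z) = cnj (V z)\<close>.
\<close>

definition is_V_cosh :: "(complex \<Rightarrow> complex) \<Rightarrow> bool" where
  "is_V_cosh V \<longleftrightarrow>
     (\<forall>t::real. t > 0 \<longrightarrow>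
        V (\<i> * of_real t) = \<i> * of_real (1 - t * beta1 (t / 2)) \<and>
        V (cnj (\<i> * of_real t)) = cnj (V (\<i> * of_real t)))"

end

theory Submission
  imports Defs "HOL-Real_Asymp.Real_Asymp"
begin

text \<open>
  The kernel of the representation satisfies
  \<open>(1 + \<i> * t * x) / (\<i> * t - x) = - \<i> * t - \<i> * (1 - t\<^sup>2) / (t + \<i> * x)\<close>,
  so for \<open>t > 0\<close> the representation says
  \<open>V (\<i> * t) = a - \<i> * t * m - \<i> * (1 - t\<^sup>2) * W t\<close>, where \<open>m\<close> is the mass of \<open>M\<close> and \<open>W t\<close> is the
  integral of \<open>1 / (t + \<i> * x)\<close>.

  Uniqueness.  At \<open>t = 1\<close> the last term drops out, and \<open>beta1 (1 / 2) = pi / 2\<close> gives \<open>a = 0\<close> and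
  \<open>m = pi / 2 - 1\<close>.  For \<open>t \<noteq> 1\<close> the value \<open>W t\<close> is thereby known, and by Fubini it is the Laplace
  transform at \<open>t\<close> of the bounded continuous function \<open>s \<mapsto> char M (- s)\<close> (\<open>Laplace_char\<close>).  Such a
  function is determined by its Laplace transform at the integers \<open>t \<ge> 2\<close>
  (\<open>Laplace_eq_0_imp_eq_0\<close>).  It remains to see that the claimed function \<open>h\<close> has this transform.
  It solves \<open>h'' = h - 1 / (cosh s)\<^sup>2\<close>, so integration by parts reduces its transform to
  that of \<open>tanh\<close>, which a geometric series evaluates in terms of the beta function
  (\<open>cosh_char_Laplace\<close>).

  Existence.  The measure with density \<open>x / sinh (pi * x / 2) / (2 * (1 + x\<^sup>2))\<close> works.  By symmetry only
  the imaginary part of the kernel contributes, and the claim becomes that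
  \<open>x / sinh (pi * x / 2) / (2 * (x\<^sup>2 + t\<^sup>2))\<close> has integral \<open>beta1 (t / 2) - 1 / t\<close>
  (\<open>has_bochner_integral_x_over_sinh\<close>).  For this the partial fraction expansion of
  \<open>x / sinh (pi * x / 2)\<close> is integrated term by term.  The expansion itself is the reflection formula
  \<open>beta z + beta (1 - z) = pi / sin (pi * z)\<close> on the imaginary axis.

  The cosine integral is the characteristic function of this particular measure, which by the
  uniqueness part must be \<open>h\<close>.
\<close>

section \<open>The beta function and the partial fractions of \<open>x / sinh x\<close>\<close>

text \<open>
  The defining Digamma expression is kept generic because the reflection formula below needs it at
  complex arguments; \<open>beta1\<close> is the real instance.
\<close>

abbreviation beta_fun :: "'a :: {real_normed_field,banach} \<Rightarrow> 'a" where
  "beta_fun z \<equiv> (Digamma ((z + 1) / 2) - Digamma (z / 2)) / 2"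

text \<open>
  The partial sums have even length because pairing consecutive terms turns them into a difference
  of two harmonic-type sums, each of which tends to a Digamma value after removal of the same
  logarithm.
\<close>

lemma beta_fun_LIMSEQ:
  fixes z :: "'a :: {real_normed_field,banach}"
  assumes "z \<noteq> 0" "z \<noteq> -1"
  shows "(\<lambda>m. \<Sum>k<2*m. (-1) ^ k / (z + of_nat k)) \<longlonglongrightarrow> beta_fun z"
proof -
  have nz: "z / 2 \<noteq> 0" "(z + 1) / 2 \<noteq> 0"
    using assms by (auto simp: add_eq_0_iff2)
  have pair: "(\<Sum>k<2*m. (-1) ^ k / (z + of_nat k)) =
      ((\<Sum>n<m. inverse (z / 2 + of_nat n)) - (\<Sum>n<m. inverse ((z + 1) / 2 + of_nat n))) / 2" for m
  proof (induction m)
    case (Suc m)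
    have half: "inverse (w / 2 + of_nat m) = 2 / (w + of_nat (2 * m))" for w :: 'a
    proof -
      have "w / 2 + of_nat m = (w + of_nat (2 * m)) / 2"
        by (simp add: add_divide_distrib)
      then show ?thesis by (simp only: inverse_divide)
    qed
    have "(\<Sum>k<2*Suc m. (-1) ^ k / (z + of_nat k)) =
        (\<Sum>k<2*m. (-1) ^ k / (z + of_nat k)) + 1 / (z + of_nat (2 * m)) - 1 / (z + 1 + of_nat (2 * m))"
      by (simp add: add_ac)
    moreover have "(P + 2 / a - (Q + 2 / b)) / 2 = (P - Q) / 2 + 1 / a - 1 / b" for P Q a b :: 'a
      by (simp add: diff_divide_distrib add_divide_distrib)
    ultimately show ?case
      by (simp only: Suc half sum.lessThan_Suc)
  qed simp
  have "(\<lambda>m. ((of_real (ln (real m)) - (\<Sum>n<m. inverse ((z + 1) / 2 + of_nat n))) -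
              (of_real (ln (real m)) - (\<Sum>n<m. inverse (z / 2 + of_nat n)))) / 2)
        \<longlonglongrightarrow> beta_fun z"
    by (intro tendsto_intros Digamma_LIMSEQ nz) simp
  then show ?thesis
    by (simp add: pair)
qed

text \<open>
  Differentiate \<open>rGamma z * rGamma (1 - z) = sin (pi * z) / pi\<close>; the derivative of \<open>rGamma\<close> is
  \<open>- rGamma * Digamma\<close>.
\<close>

lemma Digamma_reflection:
  fixes z :: complex
  assumes "z \<notin> \<int>"
  shows "Digamma (1 - z) - Digamma z = of_real pi * cot (of_real pi * z)"
proof -
  have z: "z \<notin> \<int>\<^sub>\<le>\<^sub>0" "1 - z \<notin> \<int>\<^sub>\<le>\<^sub>0"
    using assms nonpos_Ints_Int[of z] nonpos_Ints_Int[of "1 - z"] Ints_diff[OF Ints_1, of "1 - z"]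
    by auto
  have s: "sin (of_real pi * z) \<noteq> 0"
    using assms sin_eq_0[of "of_real pi * z"] by (auto simp: mult.commute)
  have "((\<lambda>w. rGamma w * rGamma (1 - w)) has_field_derivative
      - rGamma z * Digamma z * rGamma (1 - z) + rGamma z * (- rGamma (1 - z) * Digamma (1 - z) * -1)) (at z)"
    using z by (auto intro!: derivative_eq_intros DERIV_chain2[where f = rGamma]
                 has_field_derivative_rGamma_no_nonpos_int simp: algebra_simps)
  moreover have "((\<lambda>w. rGamma w * rGamma (1 - w)) has_field_derivative cos (of_real pi * z)) (at z)"
    unfolding rGamma_reflection_complex by (auto intro!: derivative_eq_intros)
  ultimately have "- rGamma z * Digamma z * rGamma (1 - z)
      + rGamma z * (- rGamma (1 - z) * Digamma (1 - z) * -1) = cos (of_real pi * z)"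
    by (rule DERIV_unique)
  then have "rGamma z * rGamma (1 - z) * (Digamma (1 - z) - Digamma z) = cos (of_real pi * z)"
    by (simp add: algebra_simps)
  then have "sin (of_real pi * z) / of_real pi * (Digamma (1 - z) - Digamma z) = cos (of_real pi * z)"
    by (simp only: rGamma_reflection_complex)
  then show ?thesis
    using s by (simp add: cot_def field_simps)
qed

text \<open>
  The reflection formula of Digamma at \<open>z / 2\<close> and at \<open>(z + 1) / 2\<close> produces \<open>cot w + tan w\<close> with
  \<open>w = pi * z / 2\<close>, and this is \<open>2 / sin (2 * w)\<close>.
\<close>

lemma beta_fun_reflection:
  fixes z :: complex
  assumes "z \<notin> \<int>"
  shows "beta_fun z + beta_fun (1 - z) = of_real pi / sin (of_real pi * z)"
proof -
  have nI: "z / 2 \<notin> \<int>" "(z + 1) / 2 \<notin> \<int>"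
    using assms Ints_mult[of 2 "z / 2"] Ints_diff[OF Ints_mult[of 2 "(z + 1) / 2"] Ints_1]
    by (auto simp: field_simps)
  define w where "w = of_real pi * z / 2"
  have zw: "of_real pi * z = 2 * w" by (simp add: w_def)
  have "sin (of_real pi * z) \<noteq> 0"
    using assms sin_eq_0[of "of_real pi * z"] by (auto simp: mult.commute)
  then have "sin (2 * w) \<noteq> 0" by (simp only: zw not_False_eq_True)
  then have sc: "sin w \<noteq> 0" "cos w \<noteq> 0" by (auto simp: sin_double)
  have shift: "of_real pi * ((z + 1) / 2) = w + of_real (pi / 2)"
    by (simp add: w_def field_simps)
  have "sin (of_real (pi / 2)) = (1 :: complex)" "cos (of_real (pi / 2)) = (0 :: complex)"
    by (simp_all only: sin_of_real cos_of_real sin_pi_half cos_pi_half of_real_1 of_real_0)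
  then have cot_shift: "cot (w + of_real (pi / 2)) = - (sin w / cos w)"
    by (simp add: cot_def sin_add cos_add del: of_real_divide)
  have c1: "Digamma (1 - z / 2) - Digamma (z / 2) = of_real pi * cot w"
    using Digamma_reflection[OF nI(1)] by (simp add: w_def)
  have c2: "Digamma ((1 - z) / 2) - Digamma ((z + 1) / 2) = of_real pi * - (sin w / cos w)"
  proof -
    have "1 - (z + 1) / 2 = (1 - z) / 2" by (simp add: field_simps)
    with Digamma_reflection[OF nI(2)] show ?thesis
      by (simp only: shift cot_shift)
  qed
  have "(1 - z + 1) / 2 = 1 - z / 2" by (simp add: field_simps)
  then have "beta_fun z + beta_fun (1 - z) =
      ((Digamma (1 - z / 2) - Digamma (z / 2)) - (Digamma ((1 - z) / 2) - Digamma ((z + 1) / 2))) / 2"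
    by (simp only:) (simp add: diff_divide_distrib)
  also have "\<dots> = of_real pi * (cot w + sin w / cos w) / 2"
    unfolding c1 c2 by (simp add: algebra_simps)
  also have "cot w + sin w / cos w = 2 / sin (2 * w)"
  proof -
    have "cot w + sin w / cos w = (sin w ^ 2 + cos w ^ 2) / (sin w * cos w)"
      using sc by (simp add: cot_def field_simps power2_eq_square)
    then show ?thesis by (simp add: sin_double)
  qed
  finally show ?thesis by (simp add: zw)
qed

text \<open>
  The point \<open>1 / 2\<close> is fixed by \<open>z \<mapsto> 1 - z\<close>, so the reflection formula determines the value there.
  Decreased by \<open>1\<close> it is the total mass of the representing measure.
\<close>

lemma beta1_one_half: "beta1 (1 / 2) = pi / 2"
proof -
  have "(1 / 2 :: complex) \<notin> \<int>"
    using fraction_not_in_Ints[where 'a = complex, of 2 1] by simp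
  moreover have "sin (of_real pi * (1 / 2) :: complex) = 1"
  proof -
    have "sin (complex_of_real (pi * (1 / 2))) = of_real (sin (pi * (1 / 2)))"
      by (simp only: sin_of_real)
    then show ?thesis by simp
  qed
  ultimately have "beta_fun (1 / 2 :: complex) = of_real pi / 2"
    using beta_fun_reflection[of "1 / 2"] by simp
  moreover have "beta_fun (1 / 2 :: complex) = of_real (beta1 (1 / 2))"
    using Polygamma_of_real[of "3 / 4" 0, where 'a = complex]
      Polygamma_of_real[of "1 / 4" 0, where 'a = complex]
    by (simp add: beta1_def)
  ultimately have "complex_of_real (beta1 (1 / 2)) = of_real (pi / 2)"
    by (simp only: of_real_divide of_real_numeral)
  then show ?thesis by (simp only: of_real_eq_iff)
qed

text \<open>
  The partial fraction expansion \<open>1 + 2 * (\<Sum>k\<ge>1. (-1) ^ k * x\<^sup>2 / (x\<^sup>2 + 4 * k\<^sup>2))\<close>, obtained from the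
  reflection formula of the beta function at \<open>z = \<i> * x / 2\<close>.  Replacing \<open>beta (1 - z)\<close> by
  \<open>- 1 / z - beta (- z)\<close> puts both series over the same index, and their \<open>k\<close>-th terms combine to a
  rational function of \<open>z\<^sup>2\<close>, hence of \<open>x\<^sup>2\<close>.  The summand \<open>k = 0\<close> equals \<open>2\<close>, which explains the
  subtracted \<open>1\<close>.
\<close>

lemma x_over_sinh_LIMSEQ:
  fixes x :: real
  assumes x: "x \<noteq> 0"
  shows "(\<lambda>m. (\<Sum>k<2*m. (-1) ^ k * (2 * x\<^sup>2 / (x\<^sup>2 + (2 * real k)\<^sup>2))) - 1) \<longlonglongrightarrow>
           (pi * x / 2) / sinh (pi * x / 2)"
proof -
  define z :: complex where "z = \<i> * of_real (x / 2)"
  have z: "z \<notin> \<int>"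
    using x by (auto simp: z_def Ints_def complex_eq_iff)
  have z0: "z \<noteq> 0" "z \<noteq> -1" "-z \<noteq> 0" "- z \<noteq> -1"
    using x by (auto simp: z_def complex_eq_iff)
  have z2: "z\<^sup>2 = - of_real ((x / 2)\<^sup>2)"
    by (simp add: z_def power_mult_distrib power_divide)
  have "(1 - z + 1) / 2 = - z / 2 + 1" "(1 - z) / 2 = (- z + 1) / 2"
    by (simp_all add: field_simps)
  moreover have "Digamma (- z / 2 + 1) = Digamma (- z / 2) - 2 / z"
    using Digamma_plus1[of "- z / 2"] z0 by simp
  ultimately have "beta_fun (1 - z) = - 1 / z - beta_fun (- z)"
    by (simp only:) (simp add: diff_divide_distrib)
  moreover have "u + (- 1 / z - v) = u - v - 1 / z" for u v :: complex
    by simp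
  ultimately have refl: "beta_fun z - beta_fun (- z) - 1 / z = of_real pi / sin (of_real pi * z)"
    using beta_fun_reflection[OF z] by (simp only:)
  have sin: "sin (of_real pi * z) = \<i> * of_real (sinh (pi * x / 2))"
  proof -
    have "sin (\<i> * of_real y) = \<i> * of_real (sinh y)" for y :: real
    proof -
      have "of_real (sinh y) = sinh (complex_of_real y)"
        by (simp add: sinh_field_def flip: exp_of_real)
      then show ?thesis by (simp add: sinh_conv_sin)
    qed
    moreover have "of_real pi * z = \<i> * of_real (pi * x / 2)"
      by (simp add: z_def)
    ultimately show ?thesis by (simp only:)
  qed
  have lim: "(\<lambda>m. z * ((\<Sum>k<2*m. (-1) ^ k / (z + of_nat k)) - (\<Sum>k<2*m. (-1) ^ k / (- z + of_nat k)) - 1 / z))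
      \<longlonglongrightarrow> z * (of_real pi / (\<i> * of_real (sinh (pi * x / 2))))"
    using tendsto_mult[OF tendsto_const[of z] tendsto_diff[OF tendsto_diff[OF
        beta_fun_LIMSEQ[OF z0(1,2)] beta_fun_LIMSEQ[OF z0(3,4)]] tendsto_const[of "1 / z"]]]
    by (simp only: refl sin)
  have summand: "z * ((-1) ^ k / (z + of_nat k) - (-1) ^ k / (- z + of_nat k)) =
      of_real ((-1) ^ k * (2 * x\<^sup>2 / (x\<^sup>2 + (2 * real k)\<^sup>2)))" for k
  proof -
    have nz: "z + of_nat k \<noteq> 0" "- z + of_nat k \<noteq> 0" "x\<^sup>2 + (2 * real k)\<^sup>2 \<noteq> 0"
      using x by (auto simp: z_def complex_eq_iff add_nonneg_eq_0_iff)
    have "z * ((-1) ^ k / (z + of_nat k) - (-1) ^ k / (- z + of_nat k)) =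
        (-1) ^ k * (- 2 * z\<^sup>2 / (of_nat k ^ 2 - z\<^sup>2))"
    proof -
      have "of_nat k ^ 2 - z\<^sup>2 = (z + of_nat k) * (- z + of_nat k)"
        by (simp add: power2_eq_square algebra_simps)
      moreover have "1 / (z + of_nat k) - 1 / (- z + of_nat k) =
          (1 * (- z + of_nat k) - 1 * (z + of_nat k)) / ((z + of_nat k) * (- z + of_nat k))"
        by (rule diff_frac_eq[OF nz(1,2)])
      moreover have "1 * (- z + of_nat k) - 1 * (z + of_nat k) = - 2 * z"
        by simp
      ultimately have "1 / (z + of_nat k) - 1 / (- z + of_nat k) = - 2 * z / (of_nat k ^ 2 - z\<^sup>2)"
        by (simp only:)
      moreover have "z * (c / u - c / v) = c * (z * (1 / u - 1 / v))" for c u v :: complex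
        by (simp add: right_diff_distrib mult_ac)
      moreover have "z * (- 2 * z / w) = - 2 * z\<^sup>2 / w" for w
        by (simp add: power2_eq_square)
      ultimately show ?thesis by (simp only:)
    qed
    also have "- 2 * z\<^sup>2 / (of_nat k ^ 2 - z\<^sup>2) =
        complex_of_real ((2 * (x / 2)\<^sup>2) / ((real k)\<^sup>2 + (x / 2)\<^sup>2))"
      by (simp add: z2)
    also have "(2 * (x / 2)\<^sup>2) / ((real k)\<^sup>2 + (x / 2)\<^sup>2) = 2 * x\<^sup>2 / (x\<^sup>2 + (2 * real k)\<^sup>2)"
    proof -
      have "(2 * (x / 2)\<^sup>2) / ((real k)\<^sup>2 + (x / 2)\<^sup>2) =
        (4 * (2 * (x / 2)\<^sup>2)) / (4 * ((real k)\<^sup>2 + (x / 2)\<^sup>2))"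
        by (rule mult_divide_mult_cancel_left[symmetric]) simp
      then show ?thesis by (simp add: power_mult_distrib power_divide algebra_simps)
    qed
    finally show ?thesis by simp
  qed
  have "z * ((\<Sum>k<2*m. (-1) ^ k / (z + of_nat k)) - (\<Sum>k<2*m. (-1) ^ k / (- z + of_nat k)) - 1 / z) =
      of_real ((\<Sum>k<2*m. (-1) ^ k * (2 * x\<^sup>2 / (x\<^sup>2 + (2 * real k)\<^sup>2))) - 1)" for m
  proof -
    have "z * ((\<Sum>k<2*m. (-1) ^ k / (z + of_nat k)) - (\<Sum>k<2*m. (-1) ^ k / (- z + of_nat k)) - 1 / z) =
      (\<Sum>k<2*m. z * ((-1) ^ k / (z + of_nat k) - (-1) ^ k / (- z + of_nat k))) - 1"
      using z0 by (simp add: sum_subtractf sum_distrib_left right_diff_distrib)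
    then show ?thesis by (simp only: summand of_real_sum of_real_diff of_real_1)
  qed
  moreover have "z * (of_real pi / (\<i> * of_real (sinh (pi * x / 2)))) =
      of_real ((pi * x / 2) / sinh (pi * x / 2))"
    by (simp add: z_def)
  ultimately show ?thesis
    using lim by (simp only: tendsto_of_real_iff)
qed

lemma alternating_sum_bounds:
  fixes a :: "nat \<Rightarrow> real"
  assumes dec: "\<And>k. a (Suc k) \<le> a k" and nn: "\<And>k. 0 \<le> a k"
  shows "0 \<le> (\<Sum>k<2*m. (-1) ^ k * a k) \<and> (\<Sum>k<2*m. (-1) ^ k * a k) \<le> a 0 - a (2*m)"
proof (induction m)
  case (Suc m)
  have "(\<Sum>k<2*Suc m. (-1) ^ k * a k) = (\<Sum>k<2*m. (-1) ^ k * a k) + a (2*m) - a (2*m+1)"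
    by simp
  with Suc show ?case using dec[of "2*m"] dec[of "2*m+1"] by simp
qed simp

text \<open>
  The expansion alternates with decreasing terms starting at \<open>2\<close>.  The resulting uniform bound makes
  \<open>1 / (x\<^sup>2 + t\<^sup>2)\<close> a dominating function when the expansion is integrated term by term against that
  weight.
\<close>

lemma x_over_sinh_partial_bound:
  fixes x :: real
  assumes "x \<noteq> 0"
  shows "\<bar>(\<Sum>k<2*m. (-1) ^ k * (2 * x\<^sup>2 / (x\<^sup>2 + (2 * real k)\<^sup>2))) - 1\<bar> \<le> 1"
proof -
  define a where "a k = 2 * x\<^sup>2 / (x\<^sup>2 + (2 * real k)\<^sup>2)" for k
  have "a (Suc k) \<le> a k" for k
    unfolding a_def using assms
    by (intro divide_left_mono mult_pos_pos add_left_mono power_mono add_pos_nonneg) auto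
  moreover have nn: "0 \<le> a k" for k by (simp add: a_def)
  ultimately have "0 \<le> (\<Sum>k<2*m. (-1) ^ k * a k) \<and> (\<Sum>k<2*m. (-1) ^ k * a k) \<le> a 0 - a (2*m)"
    by (rule alternating_sum_bounds)
  moreover have "a 0 = 2" using assms by (simp add: a_def)
  ultimately show ?thesis using nn[of "2*m"] unfolding a_def by linarith
qed

section \<open>Rational integrals over the real line\<close>

lemma has_bochner_integral_FTC_real_line:
  fixes f F :: "real \<Rightarrow> real"
  assumes "\<And>x. (F has_real_derivative f x) (at x)" "\<And>x. isCont f x" "\<And>x. 0 \<le> f x"
    and "(F \<longlongrightarrow> A) at_bot" "(F \<longlongrightarrow> B) at_top"
  shows "has_bochner_integral lborel f (B - A)"
proof -
  have "set_integrable lborel (einterval (- \<infinity>) \<infinity>) f" "(LBINT x=-\<infinity>..\<infinity>. f x) = B - A"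
    using assms
    by (intro interval_integral_FTC_nonneg[where F = F]; simp add: ereal_tendsto_simps)+
  then show ?thesis
    by (simp add: has_bochner_integral_iff set_integrable_def interval_lebesgue_integral_def
        set_lebesgue_integral_def)
qed

lemma DERIV_arctan_scaled:
  fixes t :: real
  assumes "t > 0"
  shows "((\<lambda>x. arctan (x / t) / t) has_real_derivative 1 / (x\<^sup>2 + t\<^sup>2)) (at x)"
proof -
  have "((\<lambda>x. arctan (x / t) / t) has_real_derivative (inverse (1 + (x / t)\<^sup>2) * (1 / t)) / t) (at x)"
    using assms by (auto intro!: derivative_eq_intros)
  moreover have "(inverse (1 + (x / t)\<^sup>2) * (1 / t)) / t = 1 / (x\<^sup>2 + t\<^sup>2)"
  proof -
    have "t\<^sup>2 * (1 + (x / t)\<^sup>2) = x\<^sup>2 + t\<^sup>2"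
      using assms by (simp add: power_divide field_simps)
    then show ?thesis
      using assms by (simp add: power2_eq_square inverse_eq_divide mult_ac)
  qed
  ultimately show ?thesis by simp
qed

lemma has_bochner_integral_inverse_quadratic:
  fixes t :: real
  assumes "t > 0"
  shows "has_bochner_integral lborel (\<lambda>x. 1 / (x\<^sup>2 + t\<^sup>2)) (pi / t)"
proof -
  have nz: "x\<^sup>2 + t\<^sup>2 \<noteq> 0" for x :: real
    using assms by (simp add: add_nonneg_eq_0_iff)
  have "has_bochner_integral lborel (\<lambda>x. 1 / (x\<^sup>2 + t\<^sup>2)) (pi / 2 / t - (- (pi / 2)) / t)"
  proof (rule has_bochner_integral_FTC_real_line[where F = "\<lambda>x. arctan (x / t) / t"])
    have "((\<lambda>x. arctan (x / t) / t) \<longlongrightarrow> - (pi * inverse t / 2)) at_bot"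
      using assms by real_asymp
    moreover have "- (pi * inverse t / 2) = - (pi / 2) / t"
      using assms by (simp add: field_simps)
    ultimately show "((\<lambda>x. arctan (x / t) / t) \<longlongrightarrow> - (pi / 2) / t) at_bot"
      by (simp only:)
    have "((\<lambda>x. arctan (x / t) / t) \<longlongrightarrow> pi * inverse t / 2) at_top"
      using assms by real_asymp
    moreover have "pi * inverse t / 2 = pi / 2 / t"
      using assms by (simp add: field_simps)
    ultimately show "((\<lambda>x. arctan (x / t) / t) \<longlongrightarrow> pi / 2 / t) at_top"
      by (simp only:)
    show "isCont (\<lambda>x. 1 / (x\<^sup>2 + t\<^sup>2)) x" for x
      using nz[of x] by (intro continuous_intros) simp
  qed (use assms in \<open>simp_all add: DERIV_arctan_scaled\<close>)
  then show ?thesis by (simp add: field_simps)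
qed

text \<open>
  For \<open>a \<noteq> t\<close> partial fractions reduce the integral to \<open>1 / (x\<^sup>2 + a\<^sup>2)\<close> and \<open>1 / (x\<^sup>2 + t\<^sup>2)\<close>.  When the
  poles coincide the antiderivative acquires a rational part.  The case \<open>a = 0\<close> covers the first term
  of the expansion of \<open>x / sinh x\<close>; there the quotient differs from \<open>1 / (x\<^sup>2 + t\<^sup>2)\<close> at the single
  point \<open>x = 0\<close>.
\<close>

lemma has_bochner_integral_quadratic_quotient:
  fixes a t :: real
  assumes "a \<ge> 0" "t > 0"
  shows "has_bochner_integral lborel (\<lambda>x. x\<^sup>2 / ((x\<^sup>2 + a\<^sup>2) * (x\<^sup>2 + t\<^sup>2))) (pi / (a + t))"
proof -
  have nz: "x\<^sup>2 + t\<^sup>2 \<noteq> 0" for x :: real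
    using assms by (simp add: add_nonneg_eq_0_iff)
  consider "a = 0" | "a > 0" "a \<noteq> t" | "a = t" using assms by linarith
  then show ?thesis
  proof cases
    case 1
    have "AE x in lborel. 1 / (x\<^sup>2 + t\<^sup>2) = x\<^sup>2 / ((x\<^sup>2 + a\<^sup>2) * (x\<^sup>2 + t\<^sup>2))"
      using AE_lborel_singleton[of 0] by eventually_elim (simp add: 1)
    then show ?thesis
      using has_bochner_integral_inverse_quadratic[OF assms(2)]
      by (subst has_bochner_integral_cong_AE[symmetric, of "\<lambda>x. 1 / (x\<^sup>2 + t\<^sup>2)"]) (auto simp: 1)
  next
    case 2
    have nza: "x\<^sup>2 + a\<^sup>2 \<noteq> 0" for x :: real
      using 2 by (simp add: add_nonneg_eq_0_iff)
    have d: "a\<^sup>2 - t\<^sup>2 = (a + t) * (a - t)" by (simp add: power2_eq_square algebra_simps)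
    have "has_bochner_integral lborel
        (\<lambda>x. (a\<^sup>2 * (1 / (x\<^sup>2 + a\<^sup>2)) - t\<^sup>2 * (1 / (x\<^sup>2 + t\<^sup>2))) / (a\<^sup>2 - t\<^sup>2))
        ((a\<^sup>2 * (pi / a) - t\<^sup>2 * (pi / t)) / (a\<^sup>2 - t\<^sup>2))"
      using 2 assms
      by (intro has_bochner_integral_divide has_bochner_integral_diff
          has_bochner_integral_mult_right has_bochner_integral_inverse_quadratic) auto
    moreover have "(a\<^sup>2 * (1 / (x\<^sup>2 + a\<^sup>2)) - t\<^sup>2 * (1 / (x\<^sup>2 + t\<^sup>2))) / (a\<^sup>2 - t\<^sup>2) =
        x\<^sup>2 / ((x\<^sup>2 + a\<^sup>2) * (x\<^sup>2 + t\<^sup>2))" for x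
    proof -
      have "a\<^sup>2 * (1 / (x\<^sup>2 + a\<^sup>2)) - t\<^sup>2 * (1 / (x\<^sup>2 + t\<^sup>2)) =
          x\<^sup>2 * (a\<^sup>2 - t\<^sup>2) / ((x\<^sup>2 + a\<^sup>2) * (x\<^sup>2 + t\<^sup>2))"
        using nz[of x] nza[of x] by (simp add: divide_simps) (simp add: algebra_simps)
      moreover have "a\<^sup>2 - t\<^sup>2 \<noteq> 0" using 2 assms by (simp add: d)
      ultimately show ?thesis by simp
    qed
    moreover have "(a\<^sup>2 * (pi / a) - t\<^sup>2 * (pi / t)) / (a\<^sup>2 - t\<^sup>2) = pi / (a + t)"
    proof -
      have "a\<^sup>2 * (pi / a) - t\<^sup>2 * (pi / t) = pi * (a - t)"
        using 2 assms by (simp add: power2_eq_square algebra_simps)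
      then show ?thesis using 2 by (simp add: d)
    qed
    ultimately show ?thesis by simp
  next
    case 3
    have "has_bochner_integral lborel (\<lambda>x. x\<^sup>2 / ((x\<^sup>2 + t\<^sup>2) * (x\<^sup>2 + t\<^sup>2)))
       ((pi / 2 / t - 0) / 2 - ((- (pi / 2)) / t - 0) / 2)"
    proof (rule has_bochner_integral_FTC_real_line[where F = "\<lambda>x. (arctan (x / t) / t - x / (x\<^sup>2 + t\<^sup>2)) / 2"])
      show "((\<lambda>x. (arctan (x / t) / t - x / (x\<^sup>2 + t\<^sup>2)) / 2) has_real_derivative
          x\<^sup>2 / ((x\<^sup>2 + t\<^sup>2) * (x\<^sup>2 + t\<^sup>2))) (at x)" for x
      proof -
        have "((\<lambda>x. x / (x\<^sup>2 + t\<^sup>2)) has_real_derivative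
            (1 * (x\<^sup>2 + t\<^sup>2) - x * (2 * x)) / ((x\<^sup>2 + t\<^sup>2) * (x\<^sup>2 + t\<^sup>2))) (at x)"
          using nz[of x] by (auto intro!: derivative_eq_intros)
        then have "((\<lambda>x. (arctan (x / t) / t - x / (x\<^sup>2 + t\<^sup>2)) / 2) has_real_derivative
            (1 / (x\<^sup>2 + t\<^sup>2) - (1 * (x\<^sup>2 + t\<^sup>2) - x * (2 * x)) / ((x\<^sup>2 + t\<^sup>2) * (x\<^sup>2 + t\<^sup>2))) / 2) (at x)"
          by (intro DERIV_cdivide DERIV_diff DERIV_arctan_scaled assms)
        also have "(1 / (x\<^sup>2 + t\<^sup>2) - (1 * (x\<^sup>2 + t\<^sup>2) - x * (2 * x)) / ((x\<^sup>2 + t\<^sup>2) * (x\<^sup>2 + t\<^sup>2))) / 2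
          = x\<^sup>2 / ((x\<^sup>2 + t\<^sup>2) * (x\<^sup>2 + t\<^sup>2))"
          using nz[of x] by (simp add: divide_simps) (simp add: algebra_simps power2_eq_square)
        finally show ?thesis .
      qed
      have "((\<lambda>x. (arctan (x / t) / t - x / (x\<^sup>2 + t\<^sup>2)) / 2) \<longlongrightarrow> - (pi * inverse t / 4)) at_bot"
        using assms by real_asymp
      moreover have "- (pi * inverse t / 4) = (- (pi / 2) / t - 0) / 2"
        using assms by (simp add: field_simps)
      ultimately show "((\<lambda>x. (arctan (x / t) / t - x / (x\<^sup>2 + t\<^sup>2)) / 2) \<longlongrightarrow> (- (pi / 2) / t - 0) / 2) at_bot"
        by (simp only:)
      have "((\<lambda>x. (arctan (x / t) / t - x / (x\<^sup>2 + t\<^sup>2)) / 2) \<longlongrightarrow> pi * inverse t / 4) at_top"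
        using assms by real_asymp
      moreover have "pi * inverse t / 4 = (pi / 2 / t - 0) / 2"
        using assms by (simp add: field_simps)
      ultimately show "((\<lambda>x. (arctan (x / t) / t - x / (x\<^sup>2 + t\<^sup>2)) / 2) \<longlongrightarrow> (pi / 2 / t - 0) / 2) at_top"
        by (simp only:)
      show "isCont (\<lambda>x. x\<^sup>2 / ((x\<^sup>2 + t\<^sup>2) * (x\<^sup>2 + t\<^sup>2))) x" for x
        using nz[of x] by (intro continuous_intros) simp
    qed simp
    then show ?thesis using 3 by (simp add: field_simps)
  qed
qed

section \<open>A representing measure with an explicit density\<close>

lemma borel_measurable_sinh [measurable]: "(sinh :: real \<Rightarrow> real) \<in> borel_measurable borel"
  by (intro borel_measurable_continuous_onI continuous_intros)

text \<open>
  Integrating the partial fraction expansion of \<open>x / sinh (pi * x / 2)\<close> against \<open>1 / (x\<^sup>2 + t\<^sup>2)\<close> term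
  by term yields the terms \<open>2 * pi * (-1) ^ k / (2 * k + t)\<close>, which form the series of
  \<open>pi * beta1 (t / 2)\<close>.
\<close>

lemma has_bochner_integral_x_over_sinh:
  fixes t :: real
  assumes t: "t > 0"
  shows "has_bochner_integral lborel (\<lambda>x. x / sinh (pi * x / 2) / (2 * (x\<^sup>2 + t\<^sup>2)))
           (beta1 (t / 2) - 1 / t)"
proof -
  define s where "s m x = ((\<Sum>k<2*m. (-1) ^ k * (2 * x\<^sup>2 / (x\<^sup>2 + (2 * real k)\<^sup>2))) - 1) / (x\<^sup>2 + t\<^sup>2)"
    for m :: nat and x :: real
  define f where "f x = (pi * x / 2) / sinh (pi * x / 2) / (x\<^sup>2 + t\<^sup>2)" for x
  have s_integral: "has_bochner_integral lborel (s m)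
      ((\<Sum>k<2*m. (-1) ^ k * (2 * (pi / (2 * real k + t)))) - pi / t)" for m
  proof -
    have "has_bochner_integral lborel
        (\<lambda>x. (\<Sum>k<2*m. (-1) ^ k * (2 * (x\<^sup>2 / ((x\<^sup>2 + (2 * real k)\<^sup>2) * (x\<^sup>2 + t\<^sup>2))))) - 1 / (x\<^sup>2 + t\<^sup>2))
        ((\<Sum>k<2*m. (-1) ^ k * (2 * (pi / (2 * real k + t)))) - pi / t)"
      using t by (intro has_bochner_integral_diff has_bochner_integral_sum
          has_bochner_integral_mult_right has_bochner_integral_quadratic_quotient
          has_bochner_integral_inverse_quadratic) auto
    moreover have "(\<Sum>k<2*m. (-1) ^ k * (2 * (x\<^sup>2 / ((x\<^sup>2 + (2 * real k)\<^sup>2) * (x\<^sup>2 + t\<^sup>2))))) - 1 / (x\<^sup>2 + t\<^sup>2)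
        = s m x" for x
      by (simp add: s_def diff_divide_distrib sum_divide_distrib)
    ultimately show ?thesis by simp
  qed
  have [measurable]: "s m \<in> borel_measurable lborel" for m
    using s_integral[of m] by (auto simp: has_bochner_integral_iff)
  have [measurable]: "f \<in> borel_measurable lborel"
    unfolding f_def by measurable
  have w: "integrable lborel (\<lambda>x. 1 / (x\<^sup>2 + t\<^sup>2))"
    using has_bochner_integral_inverse_quadratic[OF t] by (simp add: has_bochner_integral_iff)
  have lim: "AE x in lborel. (\<lambda>m. s m x) \<longlonglongrightarrow> f x"
    using AE_lborel_singleton[of 0]
  proof eventually_elim
    case (elim x)
    have "x\<^sup>2 + t\<^sup>2 \<noteq> 0" using t by (simp add: add_nonneg_eq_0_iff)
    then show ?case
      unfolding s_def f_def by (intro tendsto_divide x_over_sinh_LIMSEQ elim tendsto_const)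
  qed
  have bound: "AE x in lborel. norm (s m x) \<le> 1 / (x\<^sup>2 + t\<^sup>2)" for m
    using AE_lborel_singleton[of 0]
  proof eventually_elim
    case (elim x)
    then show ?case
      using x_over_sinh_partial_bound[OF elim, of m] unfolding s_def
      by (simp add: divide_right_mono)
  qed
  have f_int: "integrable lborel f"
    by (rule integrable_dominated_convergence[OF _ _ w lim bound]) measurable
  have "(\<lambda>m. LBINT x. s m x) \<longlonglongrightarrow> (LBINT x. f x)"
    by (rule integral_dominated_convergence[OF _ _ w lim bound]) measurable
  moreover have "(\<lambda>m. LBINT x. s m x) \<longlonglongrightarrow> pi * beta1 (t / 2) - pi / t"
  proof -
    have "(\<lambda>m. pi * (\<Sum>k<2*m. (-1) ^ k / (t / 2 + real k)) - pi / t) \<longlonglongrightarrow> pi * beta_fun (t / 2) - pi / t"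
      using t by (intro tendsto_intros beta_fun_LIMSEQ) auto
    moreover have "(LBINT x. s m x) = pi * (\<Sum>k<2*m. (-1) ^ k / (t / 2 + real k)) - pi / t" for m
    proof -
      have "(-1) ^ k * (2 * (pi / (2 * real k + t))) = pi * ((-1) ^ k / (t / 2 + real k))" for k
        using t by (simp add: field_simps)
      then show ?thesis
        using s_integral[of m] by (simp add: has_bochner_integral_iff sum_distrib_left)
    qed
    ultimately show ?thesis by (simp add: beta1_def)
  qed
  ultimately have "(LBINT x. f x) = pi * beta1 (t / 2) - pi / t"
    by (rule LIMSEQ_unique)
  with f_int have "has_bochner_integral lborel f (pi * beta1 (t / 2) - pi / t)"
    by (simp add: has_bochner_integral_iff)
  then have "has_bochner_integral lborel (\<lambda>x. f x / pi) ((pi * beta1 (t / 2) - pi / t) / pi)"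
    by (intro has_bochner_integral_divide) auto
  moreover have "(pi * beta1 (t / 2) - pi / t) / pi = beta1 (t / 2) - 1 / t"
    by (simp add: diff_divide_distrib)
  moreover have "f x / pi = x / sinh (pi * x / 2) / (2 * (x\<^sup>2 + t\<^sup>2))" for x
    by (simp add: f_def)
  ultimately show ?thesis by simp
qed

lemma LBINT_odd_eq_0:
  fixes f :: "real \<Rightarrow> real"
  assumes "\<And>x. f (- x) = - f x"
  shows "(LBINT x. f x) = 0"
proof -
  have "(LBINT x. f x) = (LBINT x. f (- x))"
    using lborel_integral_real_affine[of "-1" f 0] by simp
  then show ?thesis by (simp add: assms)
qed

lemma LBINT_even:
  fixes f :: "real \<Rightarrow> real"
  assumes "integrable lborel f" "\<And>x. f (- x) = f x"
  shows "(LBINT x. f x) = 2 * (LBINT x:{0..}. f x)"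
proof -
  have si: "set_integrable lborel A f" if "A \<in> sets lborel" for A
    using that assms(1) unfolding set_integrable_def by (intro integrable_mult_indicator)
  have "(LBINT x. f x) = (LBINT x:{..<0} \<union> {0..}. f x)"
  proof -
    have "{..<0} \<union> {0..} = (UNIV :: real set)" by auto
    then show ?thesis by (simp add: set_lebesgue_integral_def)
  qed
  also have "\<dots> = (LBINT x:{..<0}. f x) + (LBINT x:{0..}. f x)"
    by (intro set_integral_Un si) auto
  also have "(LBINT x:{..<0}. f x) = (LBINT x:{x. - x \<in> {..<0}}. f (- x))"
    by (rule set_integral_reflect)
  also have "\<dots> = (LBINT x:{0..}. f x)"
    unfolding assms(2)
  proof (rule set_integral_cong_set)
    show "AE x in lborel. (x \<in> {0..}) = (x \<in> {x. - x \<in> {..<(0::real)}})"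
      using AE_lborel_singleton[of 0] by eventually_elim auto
  qed (use si in \<open>auto simp: set_borel_measurable_def set_integrable_def\<close>)
  finally show ?thesis by simp
qed

text \<open>
  Since \<open>x / sinh (pi * x / 2)\<close> is even, no absolute values appear.  At \<open>x = 0\<close> the division convention
  gives the value \<open>0\<close> in place of the limit \<open>1 / pi\<close>, on a null set.
\<close>

definition cosh_density :: "real \<Rightarrow> real" where
  "cosh_density x = x / sinh (pi * x / 2) / (2 * (1 + x\<^sup>2))"

definition cosh_measure :: "real measure" where
  "cosh_measure = density lborel cosh_density"

lemma x_over_sinh_nonneg: "0 \<le> x / sinh (pi * x / 2)" for x :: real
  by (cases "x \<ge> 0") (auto simp: zero_le_divide_iff mult_nonneg_nonpos)

lemma cosh_density_nonneg: "0 \<le> cosh_density x"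
  unfolding cosh_density_def by (intro divide_nonneg_nonneg x_over_sinh_nonneg) auto

lemma cosh_density_measurable [measurable]: "cosh_density \<in> borel_measurable borel"
  unfolding cosh_density_def by measurable

lemma cosh_density_even: "cosh_density (- x) = cosh_density x"
  by (simp add: cosh_density_def)

lemma integrable_cosh_density: "integrable lborel cosh_density"
  using has_bochner_integral_x_over_sinh[of 1]
  by (simp add: has_bochner_integral_iff cosh_density_def[abs_def] add.commute)

lemma finite_measure_cosh_measure: "finite_measure cosh_measure"
proof (rule finite_measureI)
  have "emeasure cosh_measure UNIV = (\<integral>\<^sup>+ x. cosh_density x \<partial>lborel)"
    by (simp add: cosh_measure_def emeasure_density)
  also have "\<dots> < \<infinity>"
    using integrable_cosh_density
    by (simp add: integrable_iff_bounded cosh_density_nonneg)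
  finally show "emeasure cosh_measure (space cosh_measure) \<noteq> \<infinity>"
    by (simp add: cosh_measure_def)
qed

text \<open>
  Separating \<open>(1 + \<i> * t * x) / (\<i> * t - x)\<close> into real and imaginary parts leaves a real part that is
  odd in \<open>x\<close>, which integrates to zero against an even density, and the imaginary part
  \<open>- t * (1 + x\<^sup>2) / (x\<^sup>2 + t\<^sup>2)\<close>, whose numerator cancels the factor \<open>1 + x\<^sup>2\<close> of the density.
\<close>

lemma voiculescu_repr_cosh_measure:
  assumes V: "is_V_cosh V"
  shows "voiculescu_repr V 0 cosh_measure"
  unfolding voiculescu_repr_def
proof (intro conjI allI impI)
  show "finite_measure cosh_measure" by (rule finite_measure_cosh_measure)
  show "sets cosh_measure = sets borel" by (simp add: cosh_measure_def)
  fix t :: real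
  assume t: "t \<noteq> 0"
  define J where "J x = x / sinh (pi * x / 2) / (2 * (x\<^sup>2 + t\<^sup>2))" for x
  define G where "G x = cosh_density x * (x * (t\<^sup>2 - 1) / (x\<^sup>2 + t\<^sup>2))" for x
  have J: "has_bochner_integral lborel J (beta1 (\<bar>t\<bar> / 2) - 1 / \<bar>t\<bar>)"
    using has_bochner_integral_x_over_sinh[of "\<bar>t\<bar>"] t by (simp add: J_def[abs_def])
  have nz: "x\<^sup>2 + t\<^sup>2 > 0" for x :: real
    using t by (intro add_nonneg_pos) auto
  have J_eq: "J x = cosh_density x * ((1 + x\<^sup>2) / (x\<^sup>2 + t\<^sup>2))" for x
  proof -
    have "q / (2 * d) = q / (2 * a) * (a / d)" if "a \<noteq> 0" for q a d :: real
      using that by simp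
    moreover have "1 + x\<^sup>2 \<noteq> 0" by (simp add: add_nonneg_eq_0_iff)
    ultimately show ?thesis
      unfolding J_def cosh_density_def by blast
  qed
  have G_int: "integrable lborel G"
  proof (rule Bochner_Integration.integrable_bound)
    show "integrable lborel (\<lambda>x. \<bar>t\<^sup>2 - 1\<bar> * J x)"
      using J by (auto simp: has_bochner_integral_iff)
    show "G \<in> borel_measurable lborel" unfolding G_def by measurable
    show "AE x in lborel. norm (G x) \<le> norm (\<bar>t\<^sup>2 - 1\<bar> * J x)"
    proof (intro AE_I2)
      fix x :: real
      \<comment> \<open>This bounds \<open>G\<close> by a multiple of the integrable function \<open>J\<close>.\<close>
      have "\<bar>x\<bar> \<le> 1 + x\<^sup>2"
        using zero_le_power2[of "\<bar>x\<bar> - 1"] by (simp add: power2_eq_square algebra_simps)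
      then have "cosh_density x * (\<bar>x\<bar> * \<bar>t\<^sup>2 - 1\<bar> / (x\<^sup>2 + t\<^sup>2))
          \<le> cosh_density x * ((1 + x\<^sup>2) * \<bar>t\<^sup>2 - 1\<bar> / (x\<^sup>2 + t\<^sup>2))"
        using nz[of x] by (intro mult_left_mono divide_right_mono mult_right_mono cosh_density_nonneg) auto
      then show "norm (G x) \<le> norm (\<bar>t\<^sup>2 - 1\<bar> * J x)"
        using nz[of x] cosh_density_nonneg[of x]
        by (simp add: G_def J_eq abs_mult abs_of_pos mult_ac)
    qed
  qed
  have "(LBINT x. G x) = 0"
    by (rule LBINT_odd_eq_0) (simp add: G_def cosh_density_even)
  then have G: "has_bochner_integral lborel G 0"
    using G_int by (simp add: has_bochner_integral_iff)
  have "has_bochner_integral lborel (\<lambda>x. complex_of_real (G x) - \<i> * of_real t * of_real (J x))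
     (of_real 0 - \<i> * of_real t * of_real (beta1 (\<bar>t\<bar> / 2) - 1 / \<bar>t\<bar>))"
    by (intro has_bochner_integral_diff has_bochner_integral_mult_right has_bochner_integral_of_real G J)
  moreover have "complex_of_real (G x) - \<i> * of_real t * of_real (J x) =
      cosh_density x *\<^sub>R ((1 + \<i> * of_real t * of_real x) / (\<i> * of_real t - of_real x))" for x
  proof -
    have "\<i> * of_real t - of_real x \<noteq> (0 :: complex)"
      using t by (simp add: complex_eq_iff)
    moreover have "complex_of_real (x\<^sup>2 + t\<^sup>2) \<noteq> 0"
      using nz[of x] by (metis less_irrefl of_real_eq_0_iff)
    moreover have "complex_of_real (x\<^sup>2 + t\<^sup>2) = (\<i> * of_real t - of_real x) * (- \<i> * of_real t - of_real x)"
      by (simp add: complex_eq_iff power2_eq_square)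
    moreover have "(1 + \<i> * of_real t * of_real x) * (- \<i> * of_real t - of_real x) =
        complex_of_real (x * (t\<^sup>2 - 1)) - \<i> * of_real t * of_real (1 + x\<^sup>2)"
      by (simp add: complex_eq_iff power2_eq_square algebra_simps)
    ultimately have "(1 + \<i> * of_real t * of_real x) / (\<i> * of_real t - of_real x) =
        (complex_of_real (x * (t\<^sup>2 - 1)) - \<i> * of_real t * of_real (1 + x\<^sup>2)) / of_real (x\<^sup>2 + t\<^sup>2)"
      by (metis (no_types, lifting) mult_divide_mult_cancel_right mult_eq_0_iff)
    moreover have "complex_of_real (G x) =
        of_real (cosh_density x) * (of_real (x * (t\<^sup>2 - 1)) / of_real (x\<^sup>2 + t\<^sup>2))"
      by (simp only: G_def of_real_mult[of "cosh_density x"] of_real_divide)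
    moreover have "complex_of_real (J x) =
        of_real (cosh_density x) * (of_real (1 + x\<^sup>2) / of_real (x\<^sup>2 + t\<^sup>2))"
      by (simp only: J_eq of_real_mult[of "cosh_density x"] of_real_divide)
    moreover have "c * (u / d) - \<i> * of_real t * (c * (v / d)) = c * ((u - \<i> * of_real t * v) / d)"
      for c d u v :: complex
      by (simp add: diff_divide_distrib right_diff_distrib mult_ac)
    ultimately show ?thesis
      by (simp only: scaleR_conv_of_real)
  qed
  ultimately have "has_bochner_integral lborel
      (\<lambda>x. cosh_density x *\<^sub>R ((1 + \<i> * of_real t * of_real x) / (\<i> * of_real t - of_real x)))
      (- \<i> * of_real t * of_real (beta1 (\<bar>t\<bar> / 2) - 1 / \<bar>t\<bar>))"
    by simp
  then have "(CLINT x|cosh_measure. (1 + \<i> * of_real t * of_real x) / (\<i> * of_real t - of_real x)) =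
      - \<i> * of_real t * of_real (beta1 (\<bar>t\<bar> / 2) - 1 / \<bar>t\<bar>)"
    unfolding cosh_measure_def
    by (subst integral_density) (auto simp: cosh_density_nonneg has_bochner_integral_iff)
  moreover have "V (\<i> * of_real t) = - \<i> * of_real t * of_real (beta1 (\<bar>t\<bar> / 2) - 1 / \<bar>t\<bar>)"
  proof -
    have factor: "- \<i> * of_real t * of_real (b - 1 / \<bar>t\<bar>) = \<i> * of_real (t * (1 / \<bar>t\<bar> - b))" for b
      by (simp add: algebra_simps)
    show ?thesis
    proof (cases "t > 0")
      case True
      then have "t * (1 / \<bar>t\<bar> - b) = 1 - t * b" for b by (simp add: right_diff_distrib)
      with True V show ?thesis by (simp only: factor) (simp add: is_V_cosh_def)
    next
      case False
      then have "- t > 0" using t by simp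
      then have "V (cnj (\<i> * of_real (- t))) = cnj (\<i> * of_real (1 - (- t) * beta1 (- t / 2)))"
        using V unfolding is_V_cosh_def by metis
      then have "V (\<i> * of_real t) = \<i> * of_real (- (1 - (- t) * beta1 (\<bar>t\<bar> / 2)))"
        using \<open>- t > 0\<close> by (simp add: algebra_simps)
      moreover have "t * (1 / \<bar>t\<bar> - b) = - (1 - (- t) * b)" for b
        using False t by (simp add: right_diff_distrib)
      ultimately show ?thesis by (simp only: factor)
    qed
  qed
  ultimately show "V (\<i> * of_real t) = of_real 0 +
      (CLINT x|cosh_measure. (1 + \<i> * of_real t * of_real x) / (\<i> * of_real t - of_real x))"
    by simp
qed

section \<open>The Laplace transform of the claimed characteristic function\<close>

lemma set_integrable_Laplace_bounded:
  fixes D :: "real \<Rightarrow> 'a::{banach, second_countable_topology, real_normed_algebra_1}"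
  assumes "t > 0" and D: "continuous_on UNIV D" and C: "\<And>s. s \<ge> 0 \<Longrightarrow> norm (D s) \<le> C"
  shows "set_integrable lborel {0<..} (\<lambda>s. exp (- (t * s)) *\<^sub>R D s)"
proof (rule set_integrable_bound)
  show "set_integrable lborel {0<..} (\<lambda>s. C * exp (- (s * t)))"
    using assms by (intro set_integrable_mult_right integrable_I0i_exp_mscale)
  have [measurable]: "D \<in> borel_measurable borel"
    by (rule borel_measurable_continuous_onI[OF D])
  show "set_borel_measurable lborel {0<..} (\<lambda>s. exp (- (t * s)) *\<^sub>R D s)"
    unfolding set_borel_measurable_def by measurable
  have "C \<ge> 0" using C[of 0] norm_ge_zero[of "D 0"] by linarith
  then show "AE s in lborel. s \<in> {0<..} \<longrightarrow> norm (exp (- (t * s)) *\<^sub>R D s) \<le> norm (C * exp (- (s * t)))"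
    using C by (intro AE_I2 impI) (simp add: mult.commute)
qed

lemma LBINT_FTC_Ioi:
  fixes f F :: "real \<Rightarrow> 'a::euclidean_space"
  assumes "\<And>s. (F has_vector_derivative f s) (at s)" "\<And>s. isCont f s"
    and "set_integrable lborel {0<..} f" and "(F \<longlongrightarrow> 0) at_top"
  shows "(LBINT s:{0<..}. f s) = - F 0"
proof -
  have F0: "(F \<longlongrightarrow> F 0) (at_right 0)"
    using has_vector_derivative_continuous[OF assms(1)[of 0]]
    by (auto simp: continuous_within intro: tendsto_mono[OF at_le])
  have "(LBINT s=ereal 0..\<infinity>. f s) = 0 - F 0"
    using assms F0
    by (intro interval_integral_FTC_integrable[where F = F]; simp add: ereal_tendsto_simps)
  then show ?thesis
    by (simp add: interval_integral_to_infinity_eq)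
qed

lemma has_bochner_integral_exp_Ioi:
  fixes u :: real
  assumes "u > 0"
  shows "has_bochner_integral lborel (\<lambda>s. indicator {0<..} s * exp (- (u * s))) (1 / u)"
  using integrable_I0i_exp_mscale[OF assms] LBINT_I0i_exp_mscale[OF assms]
  by (simp add: has_bochner_integral_iff set_integrable_def set_lebesgue_integral_def
      interval_lebesgue_integral_0_infty mult.commute)

text \<open>
  Expand \<open>1 / (1 + exp (- (2 * s)))\<close> as a geometric series and integrate term by term.  A partial sum
  of even length differs from its limit by a factor in \<open>[0, 1]\<close>, which provides the domination.
\<close>

lemma beta1_Laplace:
  fixes t :: real
  assumes t: "t > 0"
  shows "(LBINT s:{0<..}. exp (- (t * s)) * (2 / (1 + exp (- (2 * s))))) = beta1 (t / 2)"
proof -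
  define f where "f s = indicator {0<..} s * (exp (- (t * s)) * (2 / (1 + exp (- (2 * s)))))" for s :: real
  define S where "S m s = (\<Sum>k<2*m. 2 * (-1) ^ k * (indicator {0<..} s * exp (- ((t + 2 * real k) * s))))"
    for m :: nat and s :: real
  have S_eq: "S m s = f s * (1 - exp (- (2 * s)) ^ (2 * m))" for m s
  proof -
    define q where "q = exp (- (2 * s))"
    have q: "q > 0" by (simp add: q_def)
    have "exp (- ((t + 2 * real k) * s)) = exp (- (t * s)) * q ^ k" for k
      by (simp add: q_def algebra_simps flip: exp_add exp_of_nat_mult)
    then have "S m s = 2 * (indicator {0<..} s * exp (- (t * s))) * (\<Sum>k<2*m. (- q) ^ k)"
      unfolding S_def sum_distrib_left by (intro sum.cong refl) (simp add: power_minus[of q])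
    also have "(\<Sum>k<2*m. (- q) ^ k) = (1 - q ^ (2 * m)) / (1 + q)"
      using q by (subst sum_gp_strict) (auto simp: power_mult)
    finally show ?thesis by (simp add: f_def q_def)
  qed
  have S_int: "has_bochner_integral lborel (S m) (\<Sum>k<2*m. 2 * (-1) ^ k * (1 / (t + 2 * real k)))" for m
    unfolding S_def using t
    by (intro has_bochner_integral_sum has_bochner_integral_mult_right has_bochner_integral_exp_Ioi) auto
  have [measurable]: "S m \<in> borel_measurable lborel" for m
    unfolding S_def by measurable
  have [measurable]: "f \<in> borel_measurable lborel"
    unfolding f_def by measurable
  have w: "integrable lborel (\<lambda>s. 2 * (indicator {0<..} s * exp (- (t * s))))"
    using has_bochner_integral_exp_Ioi[OF t] by (auto simp: has_bochner_integral_iff)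
  have lim: "AE s in lborel. (\<lambda>m. S m s) \<longlonglongrightarrow> f s"
  proof (intro AE_I2)
    fix s :: real
    show "(\<lambda>m. S m s) \<longlonglongrightarrow> f s"
    proof (cases "s > 0")
      case True
      then have "(\<lambda>n. exp (- (2 * s)) ^ n) \<longlonglongrightarrow> 0"
        by (intro LIMSEQ_power_zero) auto
      then have "(\<lambda>m. exp (- (2 * s)) ^ (2 * m)) \<longlonglongrightarrow> 0"
        by (rule filterlim_compose) (auto intro!: filterlim_subseq simp: strict_mono_def)
      then have "(\<lambda>m. f s * (1 - exp (- (2 * s)) ^ (2 * m))) \<longlonglongrightarrow> f s * (1 - 0)"
        by (intro tendsto_intros)
      then show ?thesis by (simp add: S_eq)
    qed (simp add: S_eq f_def)
  qed
  have bound: "AE s in lborel. norm (S m s) \<le> 2 * (indicator {0<..} s * exp (- (t * s)))" for m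
  proof (intro AE_I2)
    fix s :: real
    have "norm (S m s) \<le> f s" if "s > 0"
    proof -
      have "0 \<le> f s" by (simp add: f_def add_nonneg_nonneg)
      moreover have "\<bar>1 - exp (- (2 * s)) ^ (2 * m)\<bar> \<le> 1"
        using that by (simp add: power_le_one)
      ultimately show ?thesis
        by (simp add: S_eq abs_mult mult_left_le)
    qed
    moreover have "f s \<le> 2 * (indicator {0<..} s * exp (- (t * s)))"
    proof -
      have "2 / (1 + exp (- (2 * s))) \<le> (2 :: real)"
        by (simp add: divide_le_eq add_pos_pos)
      then have "exp (- (t * s)) * (2 / (1 + exp (- (2 * s)))) \<le> exp (- (t * s)) * 2"
        by (intro mult_left_mono) auto
      then show ?thesis
        by (simp add: f_def indicator_def mult_ac)
    qed
    ultimately show "norm (S m s) \<le> 2 * (indicator {0<..} s * exp (- (t * s)))"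
      by (cases "s > 0") (auto simp: S_def)
  qed
  have "(\<lambda>m. LBINT s. S m s) \<longlonglongrightarrow> (LBINT s. f s)"
    by (rule integral_dominated_convergence[OF _ _ w lim bound]) measurable
  moreover have "(\<lambda>m. LBINT s. S m s) \<longlonglongrightarrow> beta1 (t / 2)"
  proof -
    have "(LBINT s. S m s) = (\<Sum>k<2*m. (-1) ^ k / (t / 2 + real k))" for m
    proof -
      have "2 * (-1) ^ k * (1 / (t + 2 * real k)) = (-1) ^ k / (t / 2 + real k)" for k
        using t by (simp add: field_simps)
      then show ?thesis using S_int[of m] by (simp add: has_bochner_integral_iff)
    qed
    moreover have "(\<lambda>m. \<Sum>k<2*m. (-1) ^ k / (t / 2 + real k)) \<longlonglongrightarrow> beta_fun (t / 2)"
      using t by (intro beta_fun_LIMSEQ) auto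
    ultimately show ?thesis by (simp add: beta1_def)
  qed
  ultimately have "(LBINT s. f s) = beta1 (t / 2)" by (rule LIMSEQ_unique)
  then show ?thesis by (simp add: f_def set_lebesgue_integral_def)
qed

text \<open>
  The function that turns out to be the characteristic function.  With \<open>m = pi / 2 - 1\<close> it is the
  solution of \<open>h'' = h - 1 / (cosh s)\<^sup>2\<close>, \<open>h 0 = m\<close>, \<open>h' 0 = 0\<close>.
\<close>

definition cosh_char :: "real \<Rightarrow> real" where
  "cosh_char s = 2 * sinh s * arctan (exp (- s)) + pi / 2 * exp (- s) - 1"

text \<open>
  This rests on \<open>arctan (exp s) + arctan (exp (- s)) = pi / 2\<close>.
\<close>

lemma cosh_char_even: "cosh_char (- s) = cosh_char s"
proof -
  have "arctan (exp s) = pi / 2 - arctan (exp (- s))"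
    using arctan_inverse[of "exp s"] by (simp add: exp_minus inverse_eq_divide)
  moreover have "exp s = 2 * sinh s + exp (- s)"
    by (simp add: sinh_field_def field_simps)
  then have "pi / 2 * exp s = pi / 2 * (2 * sinh s + exp (- s))"
    by (rule arg_cong)
  moreover have "2 * - S * (pi / 2 - A) + pi / 2 * (2 * S + e) = 2 * S * A + pi / 2 * e" for S A e :: real
    by (simp add: algebra_simps)
  ultimately show ?thesis
    by (simp only: cosh_char_def sinh_minus minus_minus)
qed

lemma arctan_exp_bounds: "0 \<le> arctan (exp (- s))" "arctan (exp (- s)) \<le> exp (- s)"
  by (simp_all add: arctan_le_self)

lemma sinh_arctan_bounds:
  assumes "s \<ge> 0"
  shows "0 \<le> 2 * sinh s * arctan (exp (- s))" "2 * sinh s * arctan (exp (- s)) \<le> 1"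
proof -
  show "0 \<le> 2 * sinh s * arctan (exp (- s))" using assms by simp
  have "2 * sinh s * arctan (exp (- s)) \<le> 2 * sinh s * exp (- s)"
    using assms arctan_exp_bounds(2)[of s] by (intro mult_left_mono) auto
  also have "\<dots> = 1 - exp (- s) * exp (- s)"
    by (simp add: sinh_field_def left_diff_distrib exp_minus_inverse)
  also have "\<dots> \<le> 1" by simp
  finally show "2 * sinh s * arctan (exp (- s)) \<le> 1" .
qed

lemma cosh_char_bounded:
  assumes "s \<ge> 0"
  shows "\<bar>cosh_char s\<bar> \<le> 4"
proof -
  have "0 \<le> pi / 2 * exp (- s)" "pi / 2 * exp (- s) \<le> 2 * 1"
    using assms pi_less_4 by (simp, intro mult_mono) auto
  then show ?thesis
    using sinh_arctan_bounds[OF assms] unfolding cosh_char_def by linarith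
qed

lemma continuous_on_cosh_char: "continuous_on A cosh_char"
  unfolding cosh_char_def[abs_def] by (intro continuous_intros)

lemma DERIV_arctan_exp:
  "((\<lambda>s. arctan (exp (- s))) has_real_derivative - (1 / (2 * cosh s))) (at s)"
proof -
  have "((\<lambda>s. arctan (exp (- s))) has_real_derivative inverse (1 + (exp (- s))\<^sup>2) * - exp (- s)) (at s)"
    by (auto intro!: derivative_eq_intros)
  moreover have "1 + (exp (- s))\<^sup>2 = exp (- s) * (2 * cosh s)"
    by (simp add: cosh_field_def power2_eq_square distrib_left exp_minus_inverse mult.commute[of "exp (- s)" "exp s"])
  moreover have "inverse (e * c) * - e = - (1 / c)" if "e \<noteq> 0" for e c :: real
    using that by (simp add: inverse_eq_divide)
  ultimately show ?thesis by (metis exp_not_eq_zero)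
qed

lemma DERIV_cosh_char:
  "(cosh_char has_real_derivative 2 * cosh s * arctan (exp (- s)) - pi / 2 * exp (- s) - tanh s) (at s)"
proof -
  have "((\<lambda>s. 2 * sinh s) has_real_derivative 2 * cosh s) (at s)"
    "((\<lambda>s. pi / 2 * exp (- s)) has_real_derivative pi / 2 * - exp (- s)) (at s)"
    by (auto intro!: derivative_eq_intros)
  then have "(cosh_char has_real_derivative 2 * cosh s * arctan (exp (- s)) +
      - (1 / (2 * cosh s)) * (2 * sinh s) + pi / 2 * - exp (- s) - 0) (at s)"
    unfolding cosh_char_def[abs_def]
    by (intro DERIV_diff DERIV_add DERIV_mult DERIV_arctan_exp DERIV_const)
  moreover have "- (1 / (2 * cosh s)) * (2 * sinh s) = - tanh s"
    by (simp add: tanh_def)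
  ultimately show ?thesis by (simp add: algebra_simps)
qed

text \<open>
  Write \<open>h\<close> for \<open>cosh_char\<close>.  Because \<open>h'' = h - 1 / (cosh s)\<^sup>2\<close>, the function
  \<open>exp (- (t * s)) * (- h' s - t * h s - tanh s)\<close> has the derivative
  \<open>exp (- (t * s)) * ((t\<^sup>2 - 1) * h s + t * tanh s)\<close>.  Its values at \<open>0\<close> and at infinity are
  \<open>- t * (pi / 2 - 1)\<close> and \<open>0\<close>, and \<open>tanh s = 2 / (1 + exp (- (2 * s))) - 1\<close> has a Laplace transform
  expressed by the beta function.
\<close>

lemma cosh_char_Laplace:
  fixes t :: real
  assumes t: "t > 0"
  shows "(t\<^sup>2 - 1) * (LBINT s:{0<..}. exp (- (t * s)) * cosh_char s) = t * (pi / 2 - 1) + 1 - t * beta1 (t / 2)"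
proof -
  define A where "A s = arctan (exp (- s))" for s :: real
  \<comment> \<open>The bracket is \<open>- h' s - t * h s - tanh s\<close>: the \<open>tanh\<close> cancels against the one in \<open>h'\<close>.\<close>
  define F where "F s = exp (- (t * s)) * (pi / 2 * exp (- s) - 2 * cosh s * A s - t * cosh_char s)" for s
  define f where "f s = exp (- (t * s)) * ((t\<^sup>2 - 1) * cosh_char s + t * tanh s)" for s
  have A: "(A has_real_derivative - (1 / (2 * cosh s))) (at s)" for s
    using DERIV_arctan_exp[of s] by (simp add: A_def[abs_def])
  have h: "(cosh_char has_real_derivative 2 * cosh s * A s - pi / 2 * exp (- s) - tanh s) (at s)" for s
    using DERIV_cosh_char[of s] by (simp add: A_def)
  have deriv: "(F has_real_derivative f s) (at s)" for s
  proof -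
    have E: "((\<lambda>s. exp (- (t * s))) has_real_derivative - t * exp (- (t * s))) (at s)"
      "((\<lambda>s. pi / 2 * exp (- s)) has_real_derivative - (pi / 2 * exp (- s))) (at s)"
      "((\<lambda>s. 2 * cosh s) has_real_derivative 2 * sinh s) (at s)"
      by (auto intro!: derivative_eq_intros)
    have "(F has_real_derivative
        (- t * exp (- (t * s))) * (pi / 2 * exp (- s) - 2 * cosh s * A s - t * cosh_char s) +
        (- (pi / 2 * exp (- s)) - (2 * sinh s * A s + - (1 / (2 * cosh s)) * (2 * cosh s))
          - t * (2 * cosh s * A s - pi / 2 * exp (- s) - tanh s)) * exp (- (t * s))) (at s)"
      unfolding F_def[abs_def]
      by (intro DERIV_mult DERIV_diff E A h DERIV_cmult)
    moreover have "- (1 / (2 * cosh s)) * (2 * cosh s) = - 1" by simp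
    moreover have "2 * sinh s * A s = cosh_char s - pi / 2 * exp (- s) + 1"
      by (simp add: cosh_char_def A_def)
    moreover have "(- t * e) * (p - c - t * H) + (- p - (H - p + 1 + - 1) - t * (c - p - T)) * e
        = e * ((t\<^sup>2 - 1) * H + t * T)" for e p c H T :: real
      by (simp add: algebra_simps power2_eq_square)
    ultimately show ?thesis
      by (simp only: f_def)
  qed
  have tanh_eq: "tanh s = 2 / (1 + exp (- (2 * s))) - 1" for s :: real
  proof -
    have "(1 - q) / (1 + q) = 2 / (1 + q) - 1" if "q > 0" for q :: real
      using that by (simp add: field_simps)
    then show ?thesis by (simp add: tanh_real_altdef)
  qed
  have i1: "set_integrable lborel {0<..} (\<lambda>s. exp (- (t * s)) * cosh_char s)"
    using set_integrable_Laplace_bounded[OF t continuous_on_cosh_char, of 4] cosh_char_bounded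
    by simp
  have i2: "set_integrable lborel {0<..} (\<lambda>s. exp (- (t * s)) * (2 / (1 + exp (- (2 * s)))))"
  proof -
    have "norm (2 / (1 + exp (- (2 * s)))) \<le> 2" for s :: real
      by (simp add: divide_le_eq add_pos_pos abs_of_pos)
    moreover have "continuous_on UNIV (\<lambda>s::real. 2 / (1 + exp (- (2 * s))))"
      by (intro continuous_intros) (simp add: add_nonneg_eq_0_iff)
    ultimately show ?thesis
      using set_integrable_Laplace_bounded[OF t, of "\<lambda>s. 2 / (1 + exp (- (2 * s)))" 2] by simp
  qed
  have i3: "set_integrable lborel {0<..} (\<lambda>s. exp (- (t * s)))"
    using integrable_I0i_exp_mscale[OF t] by (simp add: mult.commute)
  have I3: "(LBINT s:{0<..}. exp (- (t * s))) = 1 / t"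
    using has_bochner_integral_exp_Ioi[OF t]
    by (simp add: has_bochner_integral_iff set_lebesgue_integral_def)
  have f_eq: "f = (\<lambda>s. (t\<^sup>2 - 1) * (exp (- (t * s)) * cosh_char s) +
      (t * (exp (- (t * s)) * (2 / (1 + exp (- (2 * s))))) - t * exp (- (t * s))))"
    unfolding f_def tanh_eq by (intro ext) (simp add: algebra_simps)
  have f_int: "set_integrable lborel {0<..} f"
    unfolding f_eq by (intro set_integral_add set_integral_diff set_integrable_mult_right i1 i2 i3)
  have "(LBINT s:{0<..}. f s) = - F 0"
  proof (rule LBINT_FTC_Ioi)
    show "(F has_vector_derivative f s) (at s)" for s
      using deriv by (simp add: has_real_derivative_iff_has_vector_derivative)
    have "continuous_on UNIV f"
      unfolding f_def[abs_def] by (intro continuous_intros continuous_on_cosh_char) simp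
    then show "isCont f s" for s by (simp add: continuous_on_eq_continuous_at)
    show "(F \<longlongrightarrow> 0) at_top"
    proof (rule Lim_null_comparison)
      have "norm (F s) \<le> exp (- (t * s)) * (4 + t * 4)" if "s \<ge> 0" for s
      proof -
        have "0 \<le> pi / 2 * exp (- s)" "pi / 2 * exp (- s) \<le> 2 * 1"
          using that pi_less_4 by (simp, intro mult_mono) auto
        moreover have "0 \<le> 2 * cosh s * A s" using arctan_exp_bounds[of s] by (simp add: A_def)
        moreover have "2 * cosh s * A s \<le> 2"
        proof -
          have "2 * cosh s * A s \<le> 2 * cosh s * exp (- s)"
            using arctan_exp_bounds[of s] by (intro mult_left_mono) (auto simp: A_def)
          also have "\<dots> = 1 + exp (- s) * exp (- s)"
            by (simp add: cosh_field_def distrib_right exp_minus_inverse)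
          also have "\<dots> \<le> 1 + 1 * 1" using that by (intro add_left_mono mult_mono) auto
          finally show ?thesis by simp
        qed
        moreover have "\<bar>t * cosh_char s\<bar> \<le> t * 4"
          using cosh_char_bounded[OF that] t by (simp add: abs_mult)
        ultimately have "\<bar>pi / 2 * exp (- s) - 2 * cosh s * A s - t * cosh_char s\<bar> \<le> 4 + t * 4"
          by linarith
        then show ?thesis by (simp add: F_def abs_mult)
      qed
      then show "eventually (\<lambda>s. norm (F s) \<le> exp (- (t * s)) * (4 + t * 4)) at_top"
        by (intro eventually_at_top_linorderI[of 0])
      show "((\<lambda>s. exp (- (t * s)) * (4 + t * 4)) \<longlongrightarrow> 0) at_top"
        using t by real_asymp
    qed
  qed (rule f_int)
  also have "F 0 = - (t * (pi / 2 - 1))"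
    by (simp add: F_def A_def cosh_char_def)
  also have "(LBINT s:{0<..}. f s) =
      (t\<^sup>2 - 1) * (LBINT s:{0<..}. exp (- (t * s)) * cosh_char s) + (t * beta1 (t / 2) - t * (1 / t))"
    unfolding f_eq
    by (subst set_integral_add set_integral_diff; (intro set_integral_diff set_integrable_mult_right i1 i2 i3)?)+
      (simp only: set_integral_mult_right beta1_Laplace[OF t] I3)
  finally show ?thesis using t by simp
qed

section \<open>Characteristic functions and their Laplace transforms\<close>

lemma integrable_iexp_mult:
  fixes M :: "real measure"
  assumes fin: "finite_measure M" and M: "sets M = sets borel"
  shows "integrable M (\<lambda>x. iexp (t * x))"
proof (rule finite_measure.integrable_const_bound[OF fin, of _ 1])
  have "(\<lambda>x. iexp (t * x)) \<in> borel_measurable borel" by measurable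
  then show "(\<lambda>x. iexp (t * x)) \<in> borel_measurable M"
    by (simp add: measurable_cong_sets[OF M refl])
qed simp

lemma isCont_char_finite:
  fixes M :: "real measure"
  assumes fin: "finite_measure M" and M: "sets M = sets borel"
  shows "isCont (char M) t"
  unfolding continuous_at_sequentially
proof safe
  interpret finite_measure M by fact
  fix X assume X: "X \<longlonglongrightarrow> t"
  have meas: "(\<lambda>x. iexp (u * x)) \<in> borel_measurable M" for u
    using integrable_iexp_mult[OF fin M] by auto
  show "(char M \<circ> X) \<longlonglongrightarrow> char M t"
    unfolding comp_def char_def
    by (rule integral_dominated_convergence[where w = "\<lambda>_. 1", OF meas meas])
      (auto intro!: AE_I2 tendsto_intros X)
qed

lemma norm_char_finite_le:
  fixes M :: "real measure"
  assumes "finite_measure M"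
  shows "norm (char M t) \<le> measure M (space M)"
proof -
  interpret finite_measure M by fact
  have "norm (char M t) \<le> (\<integral>x. norm (iexp (t * x)) \<partial>M)"
    unfolding char_def by (intro integral_norm_bound)
  also have "\<dots> = measure M (space M)" by simp
  finally show ?thesis .
qed

lemma cnj_char: "cnj (char M s) = char M (- s)"
proof -
  have "char M (- s) = (CLINT x|M. cnj (iexp (s * x)))"
    by (simp add: char_def exp_cnj del: Bochner_Integration.integral_cnj)
  then show ?thesis by (simp add: char_def)
qed

lemma LBINT_Laplace_iexp:
  fixes t x :: real
  assumes "t > 0"
  shows "(LBINT s:{0<..}. exp (- (t * s)) *\<^sub>R iexp (- s * x)) = 1 / (of_real t + \<i> * of_real x)"
proof -
  define c where "c = of_real t + \<i> * complex_of_real x"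
  have c: "c \<noteq> 0" using assms by (auto simp: c_def complex_eq_iff)
  have f_eq: "exp (- (t * s)) *\<^sub>R iexp (- s * x) = exp (- (c * of_real s))" for s
    by (simp add: c_def scaleR_conv_of_real algebra_simps flip: exp_of_real exp_add)
  have "(LBINT s:{0<..}. exp (- (c * of_real s))) = - (- (exp (- (c * of_real 0)) / c))"
  proof (rule LBINT_FTC_Ioi[where F = "\<lambda>s. - (exp (- (c * of_real s)) / c)"])
    show "((\<lambda>s. - (exp (- (c * of_real s)) / c)) has_vector_derivative exp (- (c * of_real s))) (at s)" for s
    proof -
      have "((\<lambda>z. - (exp (- (c * z)) / c)) has_field_derivative exp (- (c * of_real s))) (at (of_real s))"
        using c by (auto intro!: derivative_eq_intros)
      from has_vector_derivative_real_field[OF this] show ?thesis by simp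
    qed
    show "isCont (\<lambda>s. exp (- (c * of_real s))) s" for s
      by (intro continuous_intros)
    show "set_integrable lborel {0<..} (\<lambda>s. exp (- (c * of_real s)))"
      unfolding f_eq[symmetric]
      by (rule set_integrable_Laplace_bounded[where C = 1])
        (use assms in \<open>auto intro!: continuous_intros\<close>)
    have "norm (- (exp (- (c * of_real s)) / c)) = exp (- (t * s)) / norm c" for s
      by (simp add: norm_divide flip: f_eq)
    moreover have "((\<lambda>s. exp (- (t * s)) / norm c) \<longlongrightarrow> 0) at_top"
    proof (rule tendsto_divide_zero)
      show "((\<lambda>s. exp (- (t * s))) \<longlongrightarrow> 0) at_top"
        using assms by real_asymp
    qed
    ultimately have "((\<lambda>s. norm (- (exp (- (c * of_real s)) / c))) \<longlongrightarrow> 0) at_top"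
      by (simp only:)
    then show "((\<lambda>s. - (exp (- (c * of_real s)) / c)) \<longlongrightarrow> 0) at_top"
      by (rule tendsto_norm_zero_cancel)
  qed
  then have "(LBINT s:{0<..}. exp (- (c * of_real s))) = 1 / c" by simp
  then show ?thesis unfolding f_eq by (simp only: c_def)
qed

text \<open>
  Fubini: for each \<open>x\<close> the Laplace transform of \<open>s \<mapsto> exp (- \<i> * s * x)\<close> is \<open>1 / (t + \<i> * x)\<close>, and
  \<open>exp (- (t * s))\<close> is integrable over the half line times a finite measure.
\<close>

lemma Laplace_char:
  fixes M :: "real measure"
  assumes fin: "finite_measure M" and M: "sets M = sets borel" and t: "t > 0"
  shows "(LBINT s:{0<..}. exp (- (t * s)) *\<^sub>R char M (- s)) = (CLINT x|M. 1 / (of_real t + \<i> * of_real x))"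
proof -
  interpret finite_measure M by fact
  interpret pair_sigma_finite lborel M
    by unfold_locales
  define f where "f p = indicator {0<..} (fst p) *\<^sub>R (exp (- (t * fst p)) *\<^sub>R iexp (- fst p * snd p))"
    for p :: "real \<times> real"
  have "f \<in> borel_measurable (borel \<Otimes>\<^sub>M borel)"
    unfolding f_def by measurable
  then have f_meas: "f \<in> borel_measurable (lborel \<Otimes>\<^sub>M M)"
    by (simp add: measurable_cong_sets[OF sets_pair_measure_cong[OF sets_lborel M] refl])
  have norm_f: "norm (f (s, x)) = indicator {0<..} s * exp (- (t * s))" for s x
    by (simp add: f_def)
  have f_int: "integrable (lborel \<Otimes>\<^sub>M M) f"
  proof (rule Fubini_integrable[OF f_meas])
    have "integrable lborel (\<lambda>s. indicator {0<..} s * exp (- (t * s)))"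
      using has_bochner_integral_exp_Ioi[OF t] by (simp add: has_bochner_integral_iff)
    then show "integrable lborel (\<lambda>s. \<integral>x. norm (f (s, x)) \<partial>M)"
      unfolding norm_f by (simp add: mult.assoc)
    show "AE s in lborel. integrable M (\<lambda>x. f (s, x))"
      unfolding f_def fst_conv snd_conv
      by (intro AE_I2 integrable_scaleR_right integrable_iexp_mult fin M)
  qed
  have "(LBINT s:{0<..}. exp (- (t * s)) *\<^sub>R char M (- s)) = (LBINT s. \<integral>x. f (s, x) \<partial>M)"
    by (simp add: set_lebesgue_integral_def f_def char_def)
  also have "\<dots> = (\<integral>x. (LBINT s. f (s, x)) \<partial>M)"
    by (rule Fubini_integral[symmetric]) (use f_int in \<open>simp add: case_prod_beta'\<close>)
  also have "\<dots> = (CLINT x|M. 1 / (of_real t + \<i> * of_real x))"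
    using LBINT_Laplace_iexp[OF t]
    by (simp add: f_def set_lebesgue_integral_def)
  finally show ?thesis .
qed

text \<open>
  Lerch's theorem for bounded continuous functions, from equally spaced sample points.  In the variable
  \<open>u = exp (- s)\<close> the hypothesis makes \<open>exp (- (2 * s)) * D s\<close> orthogonal to all powers of \<open>u\<close>, hence to
  all polynomials.  By Weierstrass these approximate \<open>u * D (- ln u)\<close> uniformly on \<open>[0, 1]\<close>, so that
  \<open>exp (- (3 * s)) * (D s)\<^sup>2\<close> has integral zero.  The samples start at \<open>2\<close> because a Voiculescu transform
  at \<open>t = 1\<close> gives no information on the corresponding Laplace transform.
\<close>

lemma Laplace_eq_0_imp_eq_0:
  fixes D :: "real \<Rightarrow> real"
  assumes D: "continuous_on UNIV D" and C: "\<And>s. s \<ge> 0 \<Longrightarrow> \<bar>D s\<bar> \<le> C"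
    and L: "\<And>n::nat. n \<ge> 2 \<Longrightarrow> (LBINT s:{0<..}. exp (- (real n * s)) * D s) = 0"
    and s: "s > 0"
  shows "D s = 0"
proof -
  have "C \<ge> 0" using C[of 0] by simp
  have int: "set_integrable lborel {0<..} (\<lambda>s. exp (- (a * s)) * g s)"
    if "a > 0" "continuous_on UNIV g" "\<And>s. s \<ge> 0 \<Longrightarrow> \<bar>g s\<bar> \<le> B" for a B and g :: "real \<Rightarrow> real"
    using set_integrable_Laplace_bounded[OF that(1,2), of B] that(3) by simp
  \<comment> \<open>The factor \<open>u\<close> makes \<open>f\<close> continuous at \<open>0\<close>, where \<open>- ln u\<close> tends to infinity.\<close>
  define f where "f u = (if u = 0 then 0 else u * D (- ln u))" for u :: real
  have f_cont: "continuous_on {0..1} f"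
  proof -
    have "continuous (at u within {0..1}) f" if u: "u \<in> {0..1}" for u
    proof (cases "u = 0")
      case True
      have "(f \<longlongrightarrow> 0) (at 0 within {0..1})"
      proof (rule Lim_null_comparison)
        show "eventually (\<lambda>v. norm (f v) \<le> \<bar>v\<bar> * C) (at 0 within {0..1})"
          unfolding eventually_at_filter
        proof (intro always_eventually allI impI)
          fix v :: real
          assume "v \<in> {0..1}"
          then have "\<bar>D (- ln v)\<bar> \<le> C" if "v \<noteq> 0"
            using that by (intro C) auto
          then show "norm (f v) \<le> \<bar>v\<bar> * C"
            by (cases "v = 0") (simp_all add: f_def abs_mult mult_left_mono)
        qed
        have "((\<lambda>v. \<bar>v\<bar> * C) \<longlongrightarrow> \<bar>0\<bar> * C) (at 0 within {0..1::real})"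
          by (intro tendsto_intros)
        then show "((\<lambda>v. \<bar>v\<bar> * C) \<longlongrightarrow> 0) (at 0 within {0..1})" by simp
      qed
      then show ?thesis using True by (simp add: continuous_within f_def)
    next
      case False
      then have "u > 0" using u by simp
      have "isCont D (- ln u)"
        using D by (simp add: continuous_on_eq_continuous_at)
      moreover have "isCont (\<lambda>v. - ln v) u"
        using \<open>u > 0\<close> by (intro continuous_intros) auto
      ultimately have "isCont (\<lambda>v. D (- ln v)) u"
        by (rule isCont_o2[where g = D, rotated])
      then have "isCont (\<lambda>v. v * D (- ln v)) u"
        by (rule isCont_mult[OF continuous_ident])
      moreover have "eventually (\<lambda>v. v * D (- ln v) = f v) (nhds u)"
        using eventually_nhds_in_open[of "{0<..}" u] \<open>u > 0\<close>
        by (auto simp: f_def elim!: eventually_mono)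
      ultimately have "isCont f u" using isCont_cong[of "\<lambda>v. v * D (- ln v)" f u] by simp
      then show ?thesis by (rule continuous_at_imp_continuous_at_within)
    qed
    then show ?thesis by (simp add: continuous_on_eq_continuous_within)
  qed
  have f_exp: "f (exp (- s)) = exp (- s) * D s" for s
    by (simp add: f_def)
  define I where "I = (LBINT s:{0<..}. exp (- (3 * s)) * (D s * D s))"
  have DD_int: "set_integrable lborel {0<..} (\<lambda>s. exp (- (3 * s)) * (D s * D s))"
  proof (rule int)
    show "continuous_on UNIV (\<lambda>s. D s * D s)" by (intro continuous_intros D)
    show "\<bar>D s * D s\<bar> \<le> C * C" if "s \<ge> 0" for s
      unfolding abs_mult using that \<open>C \<ge> 0\<close> by (intro mult_mono C) auto
  qed simp
  have I_le: "\<bar>I\<bar> \<le> e * (C / 2)" if "e > 0" for e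
  proof -
    obtain g where g: "real_polynomial_function g" "\<And>u. u \<in> {0..1} \<Longrightarrow> \<bar>f u - g u\<bar> < e"
      using Stone_Weierstrass_real_polynomial_function[OF compact_Icc f_cont \<open>e > 0\<close>] by metis
    obtain a N where g_eq: "g = (\<lambda>x. \<Sum>i\<le>(N::nat). a i * x ^ i)"
      using g(1) by (auto simp: real_polynomial_function_iff_sum)
    have summand: "exp (- (2 * s)) * (a i * exp (- s) ^ i * D s) = a i * (exp (- (real (i + 2) * s)) * D s)"
      for i s
      by (simp add: algebra_simps flip: exp_add exp_of_nat_mult)
    have term_int: "set_integrable lborel {0<..} (\<lambda>s. exp (- (real (i + 2) * s)) * D s)" for i
      by (rule int[OF _ D C]) auto
    have g_sum: "exp (- (2 * s)) * (g (exp (- s)) * D s) =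
        (\<Sum>i\<le>N. a i * (exp (- (real (i + 2) * s)) * D s))" for s
      unfolding g_eq sum_distrib_right sum_distrib_left
      by (intro sum.cong refl) (simp only: summand)
    have "has_bochner_integral lborel
        (\<lambda>s. \<Sum>i\<le>N. a i * (indicator {0<..} s *\<^sub>R (exp (- (real (i + 2) * s)) * D s))) (\<Sum>i\<le>N. a i * 0)"
    proof (intro has_bochner_integral_sum has_bochner_integral_mult_right)
      fix i
      show "has_bochner_integral lborel (\<lambda>s. indicator {0<..} s *\<^sub>R (exp (- (real (i + 2) * s)) * D s)) 0"
        using term_int[of i] L[of "i + 2"]
        by (simp add: has_bochner_integral_iff set_integrable_def set_lebesgue_integral_def)
    qed
    then have "has_bochner_integral lborel
        (\<lambda>s. indicator {0<..} s *\<^sub>R (exp (- (2 * s)) * (g (exp (- s)) * D s))) 0"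
      unfolding g_sum by (simp add: sum_distrib_left mult_ac)
    then have g_int: "set_integrable lborel {0<..} (\<lambda>s. exp (- (2 * s)) * (g (exp (- s)) * D s))"
      and g_0: "(LBINT s:{0<..}. exp (- (2 * s)) * (g (exp (- s)) * D s)) = 0"
      by (simp_all add: has_bochner_integral_iff set_integrable_def set_lebesgue_integral_def)
    have I_eq: "I = (LBINT s:{0<..}. exp (- (3 * s)) * (D s * D s) - exp (- (2 * s)) * (g (exp (- s)) * D s))"
      using set_integral_diff(2)[OF DD_int g_int] g_0 by (simp add: I_def)
    have "\<bar>I\<bar> \<le> (LBINT s:{0<..}. \<bar>exp (- (3 * s)) * (D s * D s) - exp (- (2 * s)) * (g (exp (- s)) * D s)\<bar>)"
      unfolding I_eq
      using set_integral_norm_bound[OF set_integral_diff(1)[OF DD_int g_int]] by (simp only: real_norm_def)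
    also have "\<dots> \<le> (LBINT s:{0<..}. e * C * exp (- (2 * s)))"
    proof (rule set_integral_mono)
      show "set_integrable lborel {0<..} (\<lambda>s. \<bar>exp (- (3 * s)) * (D s * D s) - exp (- (2 * s)) * (g (exp (- s)) * D s)\<bar>)"
        by (intro set_integrable_abs set_integral_diff(1) DD_int g_int)
      show "set_integrable lborel {0<..} (\<lambda>s. e * C * exp (- (2 * s)))"
        using integrable_I0i_exp_mscale[of 2] by (intro set_integrable_mult_right) (simp add: mult.commute)
      fix s :: real assume s: "s \<in> {0<..}"
      have "exp (- (3 * s)) = exp (- (2 * s)) * exp (- s)" by (simp flip: exp_add)
      then have "exp (- (3 * s)) * (D s * D s) - exp (- (2 * s)) * (g (exp (- s)) * D s) =
          exp (- (2 * s)) * ((f (exp (- s)) - g (exp (- s))) * D s)"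
        by (simp add: f_exp algebra_simps)
      moreover have "\<bar>(f (exp (- s)) - g (exp (- s))) * D s\<bar> \<le> e * C"
        unfolding abs_mult using s g(2)[of "exp (- s)"] \<open>e > 0\<close> by (intro mult_mono C) auto
      ultimately show "\<bar>exp (- (3 * s)) * (D s * D s) - exp (- (2 * s)) * (g (exp (- s)) * D s)\<bar>
          \<le> e * C * exp (- (2 * s))"
        by (simp add: abs_mult mult.commute)
    qed
    also have "\<dots> = e * (C / 2)"
      using has_bochner_integral_exp_Ioi[of 2]
      by (simp add: has_bochner_integral_iff set_lebesgue_integral_def)
    finally show ?thesis .
  qed
  have "I = 0"
  proof (rule ccontr)
    assume "I \<noteq> 0"
    \<comment> \<open>This choice of \<open>e\<close> makes the bound at most half of \<open>\<bar>I\<bar>\<close>.\<close>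
    then have "\<bar>I\<bar> \<le> \<bar>I\<bar> / (C + 1) * (C / 2)"
      using \<open>C \<ge> 0\<close> by (intro I_le) auto
    also have "\<dots> < \<bar>I\<bar>"
      using \<open>C \<ge> 0\<close> \<open>I \<noteq> 0\<close> by (simp add: field_simps add_nonneg_pos)
    finally show False by simp
  qed
  define h where "h s = exp (- (3 * s)) * (D s * D s)" for s
  have h_nonneg: "0 \<le> h s" for s by (simp add: h_def)
  have h_cont: "isCont h s" for s
    unfolding h_def[abs_def] using D by (intro continuous_intros) (auto simp: continuous_on_eq_continuous_at)
  have "set_integrable lborel {0<..} h"
    unfolding h_def[abs_def] by (rule DD_int)
  then have "AE s in lborel. indicator {0<..} s *\<^sub>R h s = 0"
    using \<open>I = 0\<close> h_nonneg unfolding I_def h_def[symmetric] set_lebesgue_integral_def set_integrable_def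
    by (subst (asm) integral_nonneg_eq_0_iff_AE) auto
  then have ae: "AE s in lborel. s \<in> {0<..} \<longrightarrow> h s = 0"
    by eventually_elim (auto simp: indicator_def)
  have "h s = 0"
  proof (rule ccontr)
    assume "h s \<noteq> 0"
    have "eventually (\<lambda>v. h v \<noteq> 0 \<and> v \<in> {0<..}) (nhds s)"
      using h_cont[of s] \<open>h s \<noteq> 0\<close> s
      by (intro eventually_conj eventually_nhds_in_open)
        (auto simp: isCont_def tendsto_at_iff_tendsto_nhds intro: tendsto_imp_eventually_ne)
    then obtain S where S: "open S" "s \<in> S" "\<And>v. v \<in> S \<Longrightarrow> h v \<noteq> 0 \<and> v \<in> {0<..}"
      by (auto simp: eventually_nhds)
    from ae have "AE v in lborel. v \<notin> S"
      by eventually_elim (use S(3) in auto)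
    then have "emeasure lborel S = 0"
      using S(1) by (subst (asm) AE_iff_measurable[of S]) auto
    moreover have "emeasure lborel S > 0"
      using S(1,2) open_not_negligible[of S] by (auto simp: negligible_iff_emeasure0 zero_less_iff_neq_zero)
    ultimately show False by simp
  qed
  then show ?thesis by (simp add: h_def)
qed

section \<open>Uniqueness and the value of the representation\<close>

text \<open>
  The kernel splits as
  \<open>(1 + \<i> * t * x) / (\<i> * t - x) = - \<i> * t - \<i> * (1 - t\<^sup>2) / (t + \<i> * x)\<close>.
  At \<open>t = 1\<close> the second term vanishes, and comparing real and imaginary parts gives \<open>a\<close> and the
  mass.  At \<open>t = 2, 3, \<dots>\<close> it determines the Laplace transform of \<open>s \<mapsto> char M (- s)\<close>, to which
  Lerch's theorem applies; negative arguments follow by evenness.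
\<close>

lemma voiculescu_repr_cosh_unique:
  assumes V: "is_V_cosh V" and repr: "voiculescu_repr V a M"
  shows "a = 0" "measure M UNIV = pi / 2 - 1" "char M s = of_real (cosh_char s)"
proof -
  have fin: "finite_measure M" and M: "sets M = sets borel"
    using repr by (auto simp: voiculescu_repr_def)
  interpret finite_measure M by fact
  have sp: "space M = UNIV" using sets_eq_imp_space_eq[OF M] by simp
  define m where "m = measure M UNIV"
  define W where "W t = (CLINT x|M. 1 / (of_real t + \<i> * of_real x))" for t :: real
  have eq: "\<i> * of_real (1 - t * beta1 (t / 2)) =
      of_real a + (- \<i> * of_real t * of_real m + (- \<i> * (1 - of_real t ^ 2)) * W t)" if t: "t > 0" for t
  proof -
    have nz: "of_real t + \<i> * of_real x \<noteq> (0 :: complex)" for x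
      using t by (simp add: complex_eq_iff)
    have kernel: "(1 + \<i> * of_real t * of_real x) / (\<i> * of_real t - of_real x) =
        - \<i> * of_real t + (- \<i> * (1 - of_real t ^ 2)) * (1 / (of_real t + \<i> * of_real x))" for x
    proof -
      have "\<i> * of_real t - of_real x = \<i> * (of_real t + \<i> * of_real x)"
        by (simp add: algebra_simps)
      moreover have "1 + \<i> * of_real t * of_real x =
          \<i> * (- \<i> * of_real t * (of_real t + \<i> * of_real x) - \<i> * (1 - of_real t ^ 2))"
        by (simp add: algebra_simps power2_eq_square)
      ultimately have "(1 + \<i> * of_real t * of_real x) / (\<i> * of_real t - of_real x) =
          (- \<i> * of_real t * (of_real t + \<i> * of_real x) - \<i> * (1 - of_real t ^ 2)) / (of_real t + \<i> * of_real x)"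
        by simp
      then show ?thesis using nz[of x] by (simp add: diff_divide_distrib)
    qed
    have int: "integrable M (\<lambda>x. 1 / (complex_of_real t + \<i> * of_real x))"
    proof (rule integrable_const_bound[of _ "1 / t"])
      have "(\<lambda>x. 1 / (complex_of_real t + \<i> * of_real x)) \<in> borel_measurable borel" by measurable
      then show "(\<lambda>x. 1 / (complex_of_real t + \<i> * of_real x)) \<in> borel_measurable M"
        by (simp add: measurable_cong_sets[OF M refl])
      have "t \<le> norm (complex_of_real t + \<i> * of_real x)" for x
        using complex_Re_le_cmod[of "of_real t + \<i> * of_real x"] by simp
      then show "AE x in M. norm (1 / (complex_of_real t + \<i> * of_real x)) \<le> 1 / t"
        using t by (intro AE_I2) (simp add: norm_divide frac_le)
    qed
    have "V (\<i> * of_real t) = \<i> * of_real (1 - t * beta1 (t / 2))"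
      using V t by (simp add: is_V_cosh_def)
    moreover have "V (\<i> * of_real t) = of_real a +
          (CLINT x|M. (1 + \<i> * of_real t * of_real x) / (\<i> * of_real t - of_real x))"
      using repr t by (simp add: voiculescu_repr_def)
    moreover have "(CLINT x|M. (1 + \<i> * of_real t * of_real x) / (\<i> * of_real t - of_real x)) =
        - \<i> * of_real t * of_real m + (- \<i> * (1 - of_real t ^ 2)) * W t"
    proof -
      have "has_bochner_integral M (\<lambda>x. 1 / (complex_of_real t + \<i> * of_real x)) (W t)"
        using int by (simp add: has_bochner_integral_iff W_def)
      moreover have "has_bochner_integral M (\<lambda>x. - \<i> * of_real t) (- \<i> * of_real t * of_real m)"
        by (simp add: has_bochner_integral_iff m_def sp scaleR_conv_of_real mult_ac)
      ultimately have "has_bochner_integral M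
          (\<lambda>x. - \<i> * of_real t + (- \<i> * (1 - of_real t ^ 2)) * (1 / (of_real t + \<i> * of_real x)))
          (- \<i> * of_real t * of_real m + (- \<i> * (1 - of_real t ^ 2)) * W t)"
        by (intro has_bochner_integral_add has_bochner_integral_mult_right)
      then show ?thesis unfolding kernel by (simp only: has_bochner_integral_iff)
    qed
    ultimately show ?thesis by (simp only:)
  qed
  have "\<i> * of_real (1 - pi / 2) = of_real a - \<i> * of_real m"
    using eq[of 1] by (simp add: beta1_one_half)
  then have a: "a = 0" and m: "m = pi / 2 - 1"
    by (auto simp: complex_eq_iff)
  from a show "a = 0" .
  from m show "measure M UNIV = pi / 2 - 1" by (simp add: m_def)
  define c where "c s = char M (- s)" for s
  have "isCont c s" for s
    unfolding c_def
    by (rule isCont_o2[where f = uminus and g = "char M"]) (simp_all add: isCont_char_finite fin M)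
  then have c_cont: "continuous_on UNIV c"
    by (simp add: continuous_on_eq_continuous_at)
  have c_le: "norm (c s) \<le> m" for s
    using norm_char_finite_le[OF fin] by (simp add: c_def m_def sp)
  have L: "(LBINT s:{0<..}. exp (- (real n * s)) *\<^sub>R c s) =
      of_real (LBINT s:{0<..}. exp (- (real n * s)) * cosh_char s)" if "n \<ge> 2" for n
  proof -
    define t where "t = real n"
    have t: "t > 0" "1 - t\<^sup>2 \<noteq> 0"
      using that by (auto simp: t_def power2_eq_1_iff)
    define L where "L = (LBINT s:{0<..}. exp (- (t * s)) * cosh_char s)"
    have "(1 - of_real t ^ 2) * W t = of_real (t * beta1 (t / 2) - 1 - t * m)"
      using eq[OF t(1)] by (simp add: a complex_eq_iff algebra_simps)
    also have "t * beta1 (t / 2) - 1 - t * m = (1 - t\<^sup>2) * L"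
      using cosh_char_Laplace[OF t(1)] by (simp add: L_def m algebra_simps)
    finally have "of_real (1 - t\<^sup>2) * W t = of_real (1 - t\<^sup>2) * of_real L"
      by simp
    then have "W t = of_real L"
      using t(2) by (metis mult_left_cancel of_real_eq_0_iff)
    then show ?thesis
      using Laplace_char[OF fin M t(1)] by (simp add: W_def L_def c_def t_def)
  qed
  have eq_pos: "c s = of_real (cosh_char s)" if "s > 0" for s
  proof -
    have h_int: "set_integrable lborel {0<..} (\<lambda>s. exp (- (real n * s)) * cosh_char s)" if "n \<ge> 2" for n
      using set_integrable_Laplace_bounded[OF _ continuous_on_cosh_char, of "real n" 4] cosh_char_bounded that
      by simp
    have c_int: "set_integrable lborel {0<..} (\<lambda>s. exp (- (real n * s)) *\<^sub>R c s)" if "n \<ge> 2" for n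
      using set_integrable_Laplace_bounded[OF _ c_cont, of "real n" m] c_le that by simp
    have Re_c: "set_integrable lborel {0<..} (\<lambda>s. exp (- (real n * s)) * Re (c s))"
      "(LBINT s:{0<..}. exp (- (real n * s)) * Re (c s)) = Re (LBINT s:{0<..}. exp (- (real n * s)) *\<^sub>R c s)"
      if "n \<ge> 2" for n
      using integrable_Re[OF c_int[OF that, unfolded set_integrable_def]]
        integral_Re[OF c_int[OF that, unfolded set_integrable_def]]
      by (simp_all add: set_integrable_def set_lebesgue_integral_def mult.assoc)
    have Im_c: "(LBINT s:{0<..}. exp (- (real n * s)) * Im (c s)) = Im (LBINT s:{0<..}. exp (- (real n * s)) *\<^sub>R c s)"
      if "n \<ge> 2" for n
      using integral_Im[OF c_int[OF that, unfolded set_integrable_def]]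
      by (simp add: set_lebesgue_integral_def mult.assoc)
    have "Re (c s) - cosh_char s = 0"
    proof (rule Laplace_eq_0_imp_eq_0[OF _ _ _ that])
      show "continuous_on UNIV (\<lambda>s. Re (c s) - cosh_char s)"
        by (intro continuous_intros c_cont continuous_on_cosh_char)
      show "\<bar>Re (c s) - cosh_char s\<bar> \<le> m + 4" if "s \<ge> 0" for s
        using c_le[of s] abs_Re_le_cmod[of "c s"] cosh_char_bounded[OF that] by linarith
      show "(LBINT s:{0<..}. exp (- (real n * s)) * (Re (c s) - cosh_char s)) = 0" if "n \<ge> 2" for n
        unfolding right_diff_distrib
        using set_integral_diff(2)[OF Re_c(1)[OF that] h_int[OF that]] by (simp add: Re_c(2) L that)
    qed
    moreover have "Im (c s) = 0"
    proof (rule Laplace_eq_0_imp_eq_0[OF _ _ _ that])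
      show "continuous_on UNIV (\<lambda>s. Im (c s))"
        by (intro continuous_intros c_cont)
      show "\<bar>Im (c s)\<bar> \<le> m" if "s \<ge> 0" for s
        using c_le[of s] abs_Im_le_cmod[of "c s"] by linarith
      show "(LBINT s:{0<..}. exp (- (real n * s)) * Im (c s)) = 0" if "n \<ge> 2" for n
        by (simp add: Im_c L that)
    qed
    ultimately show ?thesis by (simp add: complex_eq_iff)
  qed
  consider "s < 0" | "s = 0" | "s > 0" by linarith
  then show "char M s = of_real (cosh_char s)"
  proof cases
    case 1
    then show ?thesis using eq_pos[of "- s"] by (simp add: c_def cosh_char_even)
  next
    case 2
    have "char M 0 = of_real m"
      by (simp add: char_def m_def sp scaleR_conv_of_real)
    with 2 show ?thesis by (simp add: m cosh_char_def)
  next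
    case 3
    then have "cnj (char M (- s)) = of_real (cosh_char s)"
      using eq_pos[of s] by (simp add: c_def)
    then show ?thesis by (simp add: cnj_char)
  qed
qed

lemma char_cosh_measure:
  "char cosh_measure s =
     of_real (LBINT x:{0..}. cos (s * x) * (\<bar>x\<bar> / (1 + x\<^sup>2)) * (1 / sinh (pi * \<bar>x\<bar> / 2)))"
proof -
  have int: "integrable lborel (\<lambda>x. cosh_density x *\<^sub>R iexp (s * x))"
    by (rule Bochner_Integration.integrable_bound[OF integrable_cosh_density])
      (auto simp: cosh_density_nonneg)
  have char_eq: "char cosh_measure s = (CLINT x|lborel. cosh_density x *\<^sub>R iexp (s * x))"
    unfolding char_def cosh_measure_def
    by (subst integral_density) (auto simp: cosh_density_nonneg)
  have Re_eq: "Re (cosh_density x *\<^sub>R iexp (s * x)) = cosh_density x * cos (s * x)"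
    and Im_eq: "Im (cosh_density x *\<^sub>R iexp (s * x)) = cosh_density x * sin (s * x)" for x
    by (simp_all add: Re_exp Im_exp)
  have "Im (char cosh_measure s) = (LBINT x. cosh_density x * sin (s * x))"
    unfolding char_eq using integral_Im[OF int] by (simp only: Im_eq)
  also have "\<dots> = 0"
    by (rule LBINT_odd_eq_0) (simp add: cosh_density_even)
  finally have Im0: "Im (char cosh_measure s) = 0" .
  have "Re (char cosh_measure s) = (LBINT x. cosh_density x * cos (s * x))"
    unfolding char_eq using integral_Re[OF int] by (simp only: Re_eq)
  also have "\<dots> = 2 * (LBINT x:{0..}. cosh_density x * cos (s * x))"
    using integrable_Re[OF int] unfolding Re_eq
    by (intro LBINT_even) (simp_all add: cosh_density_even)
  also have "\<dots> = (LBINT x:{0..}. 2 * (cosh_density x * cos (s * x)))"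
    by simp
  also have "\<dots> = (LBINT x:{0..}. cos (s * x) * (\<bar>x\<bar> / (1 + x\<^sup>2)) * (1 / sinh (pi * \<bar>x\<bar> / 2)))"
  proof (intro set_lebesgue_integral_cong allI impI)
    fix x :: real
    assume "x \<in> {0..}"
    moreover have "2 * (x / S / (2 * u) * c) = c * (x / u) * (1 / S)" for S u c :: real
      by (simp add: mult_ac)
    ultimately show "2 * (cosh_density x * cos (s * x)) =
        cos (s * x) * (\<bar>x\<bar> / (1 + x\<^sup>2)) * (1 / sinh (pi * \<bar>x\<bar> / 2))"
      by (simp only: cosh_density_def atLeast_iff abs_of_nonneg)
  qed simp
  finally show ?thesis using Im0 by (simp add: complex_eq_iff)
qed

text \<open>
  The error of the Taylor polynomial of degree \<open>7\<close> has the derivative \<open>y ^ 8 / (1 + y\<^sup>2)\<close>, which lies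
  between \<open>0\<close> and \<open>y ^ 8\<close>.
\<close>

lemma arctan_Taylor_bounds:
  fixes x :: real
  assumes "x \<ge> 0"
  shows "x - x ^ 3 / 3 + x ^ 5 / 5 - x ^ 7 / 7 \<le> arctan x"
    and "arctan x \<le> x - x ^ 3 / 3 + x ^ 5 / 5 - x ^ 7 / 7 + x ^ 9 / 9"
proof -
  define P where "P y = y - y ^ 3 / 3 + y ^ 5 / 5 - y ^ 7 / 7" for y :: real
  have inv: "inverse (1 + y\<^sup>2) = 1 - y ^ 2 + y ^ 4 - y ^ 6 + y ^ 8 / (1 + y\<^sup>2)" for y :: real
  proof -
    have "1 + y\<^sup>2 \<noteq> 0" by (simp add: add_nonneg_eq_0_iff)
    then show ?thesis by (simp add: field_simps flip: power_add)
  qed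
  have P: "(P has_real_derivative 1 - y ^ 2 + y ^ 4 - y ^ 6) (at y)" for y
    unfolding P_def[abs_def] by (auto intro!: derivative_eq_intros)
  have lower: "((\<lambda>y. arctan y - P y) has_real_derivative y ^ 8 / (1 + y\<^sup>2)) (at y)" for y
    using DERIV_diff[OF DERIV_arctan[of y] P[of y]] by (simp add: inv)
  have "arctan 0 - P 0 \<le> arctan x - P x"
  proof (rule DERIV_nonneg_imp_nondecreasing[OF assms])
    show "\<exists>d. ((\<lambda>y. arctan y - P y) has_real_derivative d) (at y) \<and> 0 \<le> d" for y
      using lower[of y] by (intro exI[of _ "y ^ 8 / (1 + y\<^sup>2)"]) simp
  qed
  then show "x - x ^ 3 / 3 + x ^ 5 / 5 - x ^ 7 / 7 \<le> arctan x"
    by (simp add: P_def)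
  have "((\<lambda>y. y ^ 9 / 9) has_real_derivative y ^ 8) (at y)" for y :: real
    by (auto intro!: derivative_eq_intros)
  then have upper: "((\<lambda>y. y ^ 9 / 9 - (arctan y - P y)) has_real_derivative y ^ 8 - y ^ 8 / (1 + y\<^sup>2)) (at y)" for y
    by (intro DERIV_diff lower)
  have "0 ^ 9 / 9 - (arctan 0 - P 0) \<le> x ^ 9 / 9 - (arctan x - P x)"
  proof (rule DERIV_nonneg_imp_nondecreasing[OF assms])
    fix y :: real
    have "y ^ 8 / (1 + y\<^sup>2) \<le> y ^ 8 / 1"
      by (intro divide_left_mono) (auto intro: add_pos_nonneg)
    then show "\<exists>d. ((\<lambda>y. y ^ 9 / 9 - (arctan y - P y)) has_real_derivative d) (at y) \<and> 0 \<le> d"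
      using upper[of y] by (intro exI[of _ "y ^ 8 - y ^ 8 / (1 + y\<^sup>2)"]) simp
  qed
  then show "arctan x \<le> x - x ^ 3 / 3 + x ^ 5 / 5 - x ^ 7 / 7 + x ^ 9 / 9"
    by (simp add: P_def)
qed

text \<open>
  Machin's formula \<open>pi / 4 = 4 * arctan (1 / 5) - arctan (1 / 239)\<close> with the Taylor bounds.
\<close>

lemma pi_half_approx: "\<bar>(pi / 2 - 1) - 0.57079\<bar> < 1 / 10 ^ 5"
proof -
  have "3.14159 < pi" "pi < 3.1416"
    using machin arctan_Taylor_bounds[of "1 / 5"] arctan_Taylor_bounds[of "1 / 239"]
    by (simp_all add: power_divide)
  then show ?thesis by (simp add: abs_less_iff)
qed

theorem proposition1:
  fixes V :: "complex \<Rightarrow> complex"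
  assumes "is_V_cosh V"
  shows "(\<exists>a M. voiculescu_repr V a M) \<and>
    (\<forall>a M. voiculescu_repr V a M \<longrightarrow>
       a = 0 \<and>
       measure M UNIV = pi / 2 - 1 \<and> \<bar>(pi / 2 - 1) - 0.57079\<bar> < 1 / 10 ^ 5 \<and>
       (\<forall>s::real.
          char M s = of_real (2 * sinh s * arctan (exp (- s)) + pi / 2 * exp (- s) - 1) \<and>
          2 * sinh s * arctan (exp (- s)) + pi / 2 * exp (- s) - 1 =
            (LBINT x:{0..}. cos (s * x) * (\<bar>x\<bar> / (1 + x\<^sup>2)) * (1 / sinh (pi * \<bar>x\<bar> / 2)))))"
proof (intro conjI allI impI)
  note repr = voiculescu_repr_cosh_measure[OF assms]
  then show "\<exists>a M. voiculescu_repr V a M" by blast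
  fix a M
  assume M: "voiculescu_repr V a M"
  show "a = 0" "measure M UNIV = pi / 2 - 1"
    using voiculescu_repr_cosh_unique[OF assms M] by auto
  show "\<bar>(pi / 2 - 1) - 0.57079\<bar> < 1 / 10 ^ 5" by (rule pi_half_approx)
  fix s
  show "char M s = of_real (2 * sinh s * arctan (exp (- s)) + pi / 2 * exp (- s) - 1)"
    using voiculescu_repr_cosh_unique(3)[OF assms M, of s] by (simp only: cosh_char_def)
  have "complex_of_real (cosh_char s) =
      of_real (LBINT x:{0..}. cos (s * x) * (\<bar>x\<bar> / (1 + x\<^sup>2)) * (1 / sinh (pi * \<bar>x\<bar> / 2)))"
    using voiculescu_repr_cosh_unique(3)[OF assms repr, of s] char_cosh_measure[of s] by simp
  then show "2 * sinh s * arctan (exp (- s)) + pi / 2 * exp (- s) - 1 =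
      (LBINT x:{0..}. cos (s * x) * (\<bar>x\<bar> / (1 + x\<^sup>2)) * (1 / sinh (pi * \<bar>x\<bar> / 2)))"
    by (simp only: of_real_eq_iff cosh_char_def)
qed

end
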